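(* For every $d \in \mathbb{N}$ there is $c > 0$ such that the following holds. Let $A$ be a binary matrix of VC-dimension at most $d$ with at least $n$ columns, no two of which are identical. Then $A$ contains an inhomogeneous square $(\alpha,\beta,\gamma)$-submatrix of size $k \times k$ for some $k \geq n^{c}$.
   Context: A submatrix of a binary matrix $A$ is any matrix obtained from $A$ by permuting and deleting rows and columns. For $\alpha,\beta,\gamma \in \{0,1\}$, a matrix $M \in \{0,1\}^{m\times k}$ is an $(\alpha,\beta,\gamma)$-matrix if $M_{i,j} = \alpha$ for $i<j$, $M_{i,j} = \beta$ for $i=j$, and $M_{i,j}=\gamma$ for $i>j$; it is inhomogeneous if $\alpha,\beta,\gamma$ are not all equal. For a set system $(X,\mathcal{F})$, a set $Y \subseteq X$ is shattered if $|\{Y\cap S : S\in\mathcal{F}\}| = 2^{|Y|}$, and the VC-dimension is the largest size of a shattered set. For $A \in \{0,1\}^{m\times n}$, its column system is $([m], \{\{i : A_{i,j}=1\} : j \in [n]\})$ and its row system is $([n], \{\{j : A_{i,j}=1\} : i \in [m]\})$; the VC-dimension of $A$ is the maximum of the VC-dimensions of its column system and its row system.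
   Formalization: The case n = 2 is excluded, since the claim fails there: the 1×2 matrix (0 1) has VC-dimension 1 and two distinct columns, but only one row, while k ≥ 2^c > 1 needs k ≥ 2; the matrix is also assumed to have at least one row. *)

theory Defs
  imports Complex_Main "HOL-Library.Extended_Nat" "Jordan_Normal_Form.Matrix"
begin

text \<open>
  Binary matrices are matrices over \<open>bool\<close>, with \<open>False\<close> and \<open>True\<close> for the entries 0 and 1.
  Rows and columns are indexed from 0.
\<close>

text \<open>
  Only finite sets are shattered; without this restriction an infinite \<open>Y\<close> (of \<open>card\<close> 0) could
  satisfy the equation by accident.
\<close>

definition shattered :: "'a set \<times> 'a set set \<Rightarrow> 'a set \<Rightarrow> bool" where
  "shattered S Y \<longleftrightarrow>
     Y \<subseteq> fst S \<and> finite Y \<and> card {Y \<inter> T | T. T \<in> snd S} = 2 ^ card Y"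

text \<open>
  If the set family is empty then not even the empty set is shattered; the supremum is then 0. This does
  not arise for matrices with at least one row and one column.
\<close>

definition vc_dim :: "'a set \<times> 'a set set \<Rightarrow> enat" where
  "vc_dim S = (SUP Y \<in> {Y. shattered S Y}. enat (card Y))"

definition column_system :: "bool mat \<Rightarrow> nat set \<times> nat set set" where
  "column_system A =
     ({..<dim_row A}, {{i. i < dim_row A \<and> A $$ (i, j)} | j. j < dim_col A})"

definition row_system :: "bool mat \<Rightarrow> nat set \<times> nat set set" where
  "row_system A =
     ({..<dim_col A}, {{j. j < dim_col A \<and> A $$ (i, j)} | i. i < dim_row A})"

definition vc_dim_mat :: "bool mat \<Rightarrow> enat" where
  "vc_dim_mat A = max (vc_dim (column_system A)) (vc_dim (row_system A))"

text \<open>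
  The injections \<open>r\<close> and \<open>s\<close> need not be increasing: rows and columns may be permuted as well as
  deleted.
\<close>

definition submatrix_of :: "'a mat \<Rightarrow> 'a mat \<Rightarrow> bool" where
  "submatrix_of M A \<longleftrightarrow>
     (\<exists>r s. inj_on r {..<dim_row M} \<and> r ` {..<dim_row M} \<subseteq> {..<dim_row A} \<and>
            inj_on s {..<dim_col M} \<and> s ` {..<dim_col M} \<subseteq> {..<dim_col A} \<and>
            (\<forall>i < dim_row M. \<forall>j < dim_col M. M $$ (i, j) = A $$ (r i, s j)))"

definition pattern_matrix :: "'a \<Rightarrow> 'a \<Rightarrow> 'a \<Rightarrow> 'a mat \<Rightarrow> bool" where
  "pattern_matrix \<alpha> \<beta> \<gamma> M \<longleftrightarrow>
     (\<forall>i < dim_row M. \<forall>j < dim_col M.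
        M $$ (i, j) = (if i < j then \<alpha> else if i = j then \<beta> else \<gamma>))"

definition inhomogeneous :: "'a \<Rightarrow> 'a \<Rightarrow> 'a \<Rightarrow> bool" where
  "inhomogeneous \<alpha> \<beta> \<gamma> \<longleftrightarrow> \<not> (\<alpha> = \<beta> \<and> \<beta> = \<gamma>)"

end

theory Submission
  imports Defs "HOL-Library.FuncSet"
begin

text \<open>
  Choose an inclusion-minimal set \<open>F\<close> of rows that separates all columns. By Sauer--Shelah the
  number of columns is at most polynomial in the size of \<open>F\<close>, and each \<open>r \<in> F\<close> has two columns \<open>c r True\<close>,
  \<open>c r False\<close> that differ in row \<open>r\<close> and in no other row of \<open>F\<close>. So for \<open>H \<subseteq> F\<close> the off-diagonal part
  of the submatrix with rows \<open>r\<close> and columns \<open>c r v\<close>, \<open>r \<in> H\<close>, does not depend on the choice of \<open>v\<close>,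
  while its diagonal can be chosen freely. It remains to make the parts above and below the diagonal
  constant, that is, to find large homogeneous sets in two graphs of bounded VC-dimension.

  Such a graph has homogeneous sets of polynomial size, by induction on the dimension. At scale \<open>m\<close>,
  either some not too small \<open>E\<close> has few \<open>m\<close>-tuples that shatter a \<open>d\<close>-set (the induction hypothesis
  then puts homogeneous sets into most tuples), or every not too small \<open>E\<close> has many such tuples. In
  the second case one collects a small set \<open>Z\<close> of vertices such that almost every vertex is constant on
  almost every class of vertices with equal trace on \<open>Z\<close>; a homogeneous tuple in general position then
  yields many large sets that are pairwise completely joined or pairwise completely unjoined. In the
  first case one continues with \<open>E\<close> at a squared scale. Since the sizes of the scales grow doubly
  exponentially, the total loss is polynomial.
\<close>

subsection \<open>The Sauer--Shelah bound\<close>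

text \<open>Induction on the ground set (Pajor's proof). Remove \<open>z\<close>: \<open>A\<close>
  collects the traces on the rest, \<open>B\<close> those that extend both with and without
  \<open>z\<close>. Sets shattered by \<open>A\<close> stay shattered by \<open>Fam\<close>, and
  sets shattered by \<open>B\<close> do so even after \<open>z\<close> is added to them.\<close>

lemma card_le_shattered:
  fixes Fam :: "'a set set"
  assumes "finite Z" "Fam \<subseteq> Pow Z"
  shows "card Fam \<le> card {Y. Y \<subseteq> Z \<and> (\<forall>X\<subseteq>Y. \<exists>S\<in>Fam. S \<inter> Y = X)}"
  using assms
proof (induction Z arbitrary: Fam rule: finite_induct)
  case empty
  show ?case
  proof (cases "Fam = {}")
    case False
    then have "Fam = {{}}" using empty by auto
    then have "{Y. Y \<subseteq> {} \<and> (\<forall>X\<subseteq>Y. \<exists>S\<in>Fam. S \<inter> Y = X)} = {{}}" by auto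
    then show ?thesis using \<open>Fam = {{}}\<close> by simp
  qed simp
next
  case (insert z Z)
  define sh where "sh Z G = {Y. Y \<subseteq> Z \<and> (\<forall>X\<subseteq>Y. \<exists>S\<in>G. S \<inter> Y = X)}" for Z :: "'a set" and G
  define A where "A = (\<lambda>S. S - {z}) ` Fam"
  define B where "B = {S. z \<notin> S \<and> S \<in> Fam \<and> insert z S \<in> Fam}"
  have finFam: "finite Fam" using insert.prems insert.hyps by (meson finite_Pow_iff finite_insert finite_subset)
  have finsh: "finite (sh X G)" if "finite X" for X G
    using that by (auto simp: sh_def intro: finite_subset[of _ "Pow X"])
  have cF: "card Fam = card A + card B"
  proof -
    define F0 where "F0 = {S\<in>Fam. z \<notin> S}"
    define F1 where "F1 = {S\<in>Fam. z \<in> S}"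
    have 1: "card Fam = card F0 + card F1"
      unfolding F0_def F1_def using finFam by (subst card_Un_disjoint[symmetric]) (auto intro: arg_cong[where f = card])
    have 2: "card ((\<lambda>S. S - {z}) ` F1) = card F1"
      by (rule card_image) (auto simp: inj_on_def F1_def)
    have 3: "A = F0 \<union> (\<lambda>S. S - {z}) ` F1"
    proof -
      have "S - {z} = S" if "S \<in> F0" for S using that unfolding F0_def by auto
      then have "(\<lambda>S. S - {z}) ` F0 = F0" by (simp add: image_def)
      moreover have "Fam = F0 \<union> F1" unfolding F0_def F1_def by auto
      ultimately show ?thesis unfolding A_def by (simp add: image_Un)
    qed
    have 4: "B = F0 \<inter> (\<lambda>S. S - {z}) ` F1"
    proof (rule Set.set_eqI)
      fix S
      have "S \<in> (\<lambda>S. S - {z}) ` F1 \<longleftrightarrow> z \<notin> S \<and> insert z S \<in> Fam"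
      proof
        assume "S \<in> (\<lambda>S. S - {z}) ` F1"
        then obtain T where "T \<in> Fam" "z \<in> T" "S = T - {z}" unfolding F1_def by auto
        then show "z \<notin> S \<and> insert z S \<in> Fam" by (simp add: insert_absorb)
      next
        assume "z \<notin> S \<and> insert z S \<in> Fam"
        then have "insert z S \<in> F1" "S = insert z S - {z}" unfolding F1_def by auto
        then show "S \<in> (\<lambda>S. S - {z}) ` F1" by (rule_tac image_eqI)
      qed
      then show "S \<in> B \<longleftrightarrow> S \<in> F0 \<inter> (\<lambda>S. S - {z}) ` F1"
        unfolding B_def F0_def by auto
    qed
    have "card F0 + card ((\<lambda>S. S - {z}) ` F1) = card A + card B"
      unfolding 3 4 using finFam by (intro card_Un_Int) (auto simp: F0_def F1_def)
    then show ?thesis using 1 2 by simp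
  qed
  have "card A \<le> card (sh Z A)" unfolding sh_def
    by (rule insert.IH) (use insert.prems in \<open>auto simp: A_def\<close>)
  moreover have "card B \<le> card (sh Z B)" unfolding sh_def
    by (rule insert.IH) (use insert.prems in \<open>auto simp: B_def\<close>)
  moreover have "card (sh Z B) = card (insert z ` sh Z B)"
  proof (rule card_image[symmetric], rule inj_onI)
    fix Y1 Y2 assume "Y1 \<in> sh Z B" "Y2 \<in> sh Z B" "insert z Y1 = insert z Y2"
    moreover from this have "z \<notin> Y1" "z \<notin> Y2" using insert.hyps unfolding sh_def by auto
    ultimately show "Y1 = Y2" by (simp add: insert_ident)
  qed
  moreover have "card (sh Z A) + card (insert z ` sh Z B) = card (sh Z A \<union> insert z ` sh Z B)"
  proof (rule card_Un_disjoint[symmetric])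
    show "sh Z A \<inter> insert z ` sh Z B = {}" using insert.hyps unfolding sh_def by auto
  qed (use finsh insert.hyps in auto)
  moreover have "card (sh Z A \<union> insert z ` sh Z B) \<le> card (sh (insert z Z) Fam)"
  proof (rule card_mono)
    show "finite (sh (insert z Z) Fam)" using finsh insert.hyps by simp
    show "sh Z A \<union> insert z ` sh Z B \<subseteq> sh (insert z Z) Fam"
    proof (intro Un_least subsetI)
      fix Y assume Y: "Y \<in> sh Z A"
      have "\<exists>S\<in>Fam. S \<inter> Y = X" if "X \<subseteq> Y" for X
      proof -
        have "\<exists>S\<in>A. S \<inter> Y = X" using Y that unfolding sh_def by simp
        then obtain S where "S \<in> Fam" "(S - {z}) \<inter> Y = X" unfolding A_def by auto
        moreover have "z \<notin> Y" using Y insert.hyps unfolding sh_def by auto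
        ultimately show ?thesis by blast
      qed
      then show "Y \<in> sh (insert z Z) Fam" using Y unfolding sh_def by auto
    next
      fix Y' assume "Y' \<in> insert z ` sh Z B"
      then obtain Y where Y: "Y \<in> sh Z B" "Y' = insert z Y" by auto
      have zY: "z \<notin> Y" using Y insert.hyps unfolding sh_def by auto
      have "\<exists>S\<in>Fam. S \<inter> Y' = X" if "X \<subseteq> Y'" for X
      proof -
        have "X - {z} \<subseteq> Y" using that Y by auto
        then have "\<exists>S\<in>B. S \<inter> Y = X - {z}" using Y unfolding sh_def by simp
        then obtain S where S: "S \<in> B" "S \<inter> Y = X - {z}" by auto
        show ?thesis
        proof (cases "z \<in> X")
          case True
          then have "insert z S \<inter> Y' = X" using S Y by auto
          then show ?thesis using S unfolding B_def by blast
        next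
          case False
          then have "S \<inter> Y' = X" using S Y unfolding B_def by auto
          then show ?thesis using S unfolding B_def by blast
        qed
      qed
      then show "Y' \<in> sh (insert z Z) Fam" using Y unfolding sh_def by auto
    qed
  qed
  ultimately show ?case unfolding cF sh_def by linarith
qed

text \<open>A set of at most \<open>d\<close> elements is the range of a \<open>d\<close>-tuple over
  \<open>Z\<close>, with a dummy value \<open>None\<close> for the places left over.\<close>

lemma card_subsets_card_le:
  assumes "finite Z"
  shows "card {Y. Y \<subseteq> Z \<and> card Y \<le> d} \<le> (card Z + 1) ^ d"
proof -
  let ?O = "insert None (Some ` Z)"
  have "{Y. Y \<subseteq> Z \<and> card Y \<le> d} \<subseteq> (\<lambda>f. {z. Some z \<in> f ` {..<d}}) ` ({..<d} \<rightarrow>\<^sub>E ?O)"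
  proof
    fix Y assume "Y \<in> {Y. Y \<subseteq> Z \<and> card Y \<le> d}"
    then have Y: "Y \<subseteq> Z" "card Y \<le> d" "finite Y" using assms finite_subset by auto
    obtain h where h: "bij_betw h {..<card Y} Y"
      using Y(3) ex_bij_betw_nat_finite by (metis atLeast0LessThan)
    define f where "f = (\<lambda>i\<in>{..<d}. if i < card Y then Some (h i) else None)"
    have "f \<in> {..<d} \<rightarrow>\<^sub>E ?O"
      using h Y unfolding f_def bij_betw_def by (auto simp: PiE_def Pi_def)
    moreover have "Y = {z. Some z \<in> f ` {..<d}}"
    proof (rule Set.set_eqI)
      fix z
      have "z \<in> Y \<longleftrightarrow> (\<exists>i<card Y. h i = z)"
        using bij_betw_imp_surj_on[OF h] by (metis imageE imageI lessThan_iff)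
      also have "\<dots> \<longleftrightarrow> (\<exists>i<d. f i = Some z)"
        using Y(2) unfolding f_def by auto
      also have "\<dots> \<longleftrightarrow> z \<in> {z. Some z \<in> f ` {..<d}}" by (auto simp: image_iff eq_commute)
      finally show "z \<in> Y \<longleftrightarrow> z \<in> {z. Some z \<in> f ` {..<d}}" .
    qed
    ultimately show "Y \<in> (\<lambda>f. {z. Some z \<in> f ` {..<d}}) ` ({..<d} \<rightarrow>\<^sub>E ?O)" by blast
  qed
  then have "card {Y. Y \<subseteq> Z \<and> card Y \<le> d} \<le> card ({..<d} \<rightarrow>\<^sub>E ?O)"
    using assms by (intro surj_card_le) (auto intro!: finite_PiE)
  also have "\<dots> = (card Z + 1) ^ d"
    using assms by (simp add: card_PiE card_image)
  finally show ?thesis .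
qed

lemma sauer_shelah:
  fixes Fam :: "'a set set"
  assumes "finite Z" "Fam \<subseteq> Pow Z"
    and "\<And>Y. Y \<subseteq> Z \<Longrightarrow> (\<And>X. X \<subseteq> Y \<Longrightarrow> \<exists>S\<in>Fam. S \<inter> Y = X) \<Longrightarrow> card Y \<le> d"
  shows "card Fam \<le> (card Z + 1) ^ d"
proof -
  have "card Fam \<le> card {Y. Y \<subseteq> Z \<and> (\<forall>X\<subseteq>Y. \<exists>S\<in>Fam. S \<inter> Y = X)}"
    by (rule card_le_shattered) fact+
  also have "\<dots> \<le> card {Y. Y \<subseteq> Z \<and> card Y \<le> d}"
    using assms by (intro card_mono) auto
  also have "\<dots> \<le> (card Z + 1) ^ d" by (rule card_subsets_card_le) fact
  finally show ?thesis .
qed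

text \<open>A tuple is determined by its restrictions to \<open>J\<close> and to
  \<open>I - J\<close>. This serves union bounds over tuples in which a bad event depends on few
  coordinates.\<close>

lemma card_PiE_restrict_le:
  assumes "finite I" "J \<subseteq> I" "finite E"
  shows "card {f \<in> I \<rightarrow>\<^sub>E E. restrict f J \<in> B} \<le> card (B \<inter> (J \<rightarrow>\<^sub>E E)) * card E ^ card (I - J)"
proof -
  have fJ: "finite J" using assms finite_subset by blast
  have "card {f \<in> I \<rightarrow>\<^sub>E E. restrict f J \<in> B} \<le> card ((B \<inter> (J \<rightarrow>\<^sub>E E)) \<times> ((I - J) \<rightarrow>\<^sub>E E))"
  proof (rule card_inj_on_le)
    show "inj_on (\<lambda>f. (restrict f J, restrict f (I - J))) {f \<in> I \<rightarrow>\<^sub>E E. restrict f J \<in> B}"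
    proof (rule inj_onI)
      fix f g assume f: "f \<in> {f \<in> I \<rightarrow>\<^sub>E E. restrict f J \<in> B}" and g: "g \<in> {f \<in> I \<rightarrow>\<^sub>E E. restrict f J \<in> B}"
        and eq: "(restrict f J, restrict f (I - J)) = (restrict g J, restrict g (I - J))"
      show "f = g"
      proof (rule PiE_ext[of f I "\<lambda>_. E" g])
        show "f i = g i" if "i \<in> I" for i
          using eq that by (cases "i \<in> J") (metis Pair_inject restrict_apply', metis DiffI Pair_inject restrict_apply')
      qed (use f g in auto)
    qed
    show "(\<lambda>f. (restrict f J, restrict f (I - J))) ` {f \<in> I \<rightarrow>\<^sub>E E. restrict f J \<in> B} \<subseteq>
       (B \<inter> (J \<rightarrow>\<^sub>E E)) \<times> ((I - J) \<rightarrow>\<^sub>E E)" using assms by auto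
    show "finite ((B \<inter> (J \<rightarrow>\<^sub>E E)) \<times> ((I - J) \<rightarrow>\<^sub>E E))"
      using assms fJ by (intro finite_cartesian_product finite_Int disjI2 finite_PiE) auto
  qed
  also have "\<dots> = card (B \<inter> (J \<rightarrow>\<^sub>E E)) * card E ^ card (I - J)"
    using assms by (simp add: card_cartesian_product card_PiE)
  finally show ?thesis .
qed

subsection \<open>Robustly shattered sets\<close>

definition cell :: "('a \<Rightarrow> 'a \<Rightarrow> bool) \<Rightarrow> 'a set \<Rightarrow> 'a set \<Rightarrow> 'a set \<Rightarrow> 'a set" where
  "cell R E Y X = {r \<in> E. \<forall>y\<in>Y. R r y \<longleftrightarrow> y \<in> X}"

text \<open>The vertices that realise the traces have to lie outside \<open>Y\<close>, so the values \<open>R x x\<close> are irrelevant.\<close>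

definition shatters :: "('a \<Rightarrow> 'a \<Rightarrow> bool) \<Rightarrow> 'a set \<Rightarrow> nat \<Rightarrow> bool" where
  "shatters R F d \<longleftrightarrow> (\<exists>Y\<subseteq>F. finite Y \<and> card Y = d \<and> (\<forall>X\<subseteq>Y. \<not> cell R F Y X \<subseteq> Y))"

text \<open>A quantitative version of shattering. The vertices of a cell may lie in \<open>Y\<close>
  here; this is harmless as soon as \<open>E\<close> has more than \<open>D * card Y\<close>
  elements.\<close>

definition robust :: "('a \<Rightarrow> 'a \<Rightarrow> bool) \<Rightarrow> nat \<Rightarrow> 'a set \<Rightarrow> 'a set \<Rightarrow> bool" where
  "robust R D E Y \<longleftrightarrow> Y \<subseteq> E \<and> (\<forall>X\<subseteq>Y. card E \<le> D * card (cell R E Y X))"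

text \<open>The threshold is one half, so a set that is not full leaves more than half of its tuples
  without a shattered \<open>d\<close>-set, and these fall under the induction hypothesis.\<close>

definition full :: "('a \<Rightarrow> 'a \<Rightarrow> bool) \<Rightarrow> nat \<Rightarrow> nat \<Rightarrow> 'a set \<Rightarrow> bool" where
  "full R d m E \<longleftrightarrow>
     card E ^ m \<le> 2 * card {f \<in> {..<m} \<rightarrow>\<^sub>E E. shatters R (f ` {..<m}) d}"

lemma shatters_mono:
  assumes "shatters R F d" "F \<subseteq> G"
  shows "shatters R G d"
proof -
  obtain Y where Y: "Y \<subseteq> F" "finite Y" "card Y = d" "\<forall>X\<subseteq>Y. \<not> cell R F Y X \<subseteq> Y"
    using assms(1) unfolding shatters_def by blast
  have "cell R F Y X \<subseteq> cell R G Y X" for X using assms(2) unfolding cell_def by auto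
  then have "\<forall>X\<subseteq>Y. \<not> cell R G Y X \<subseteq> Y" using Y(4) by blast
  then show ?thesis using Y(1-3) assms(2) unfolding shatters_def by blast
qed

text \<open>If a tuple shatters a \<open>d\<close>-set that is not robust, then some entry of the tuple falls into one of the
  small cells of that set, which is unlikely by the choice of \<open>D\<close>.\<close>

lemma many_robust:
  fixes E :: "'a set"
  assumes "finite E" "E \<noteq> {}" "0 < m" and full: "full R d m E" and D: "D = 4 * 2 ^ d * m ^ (d + 1)"
  shows "card E ^ d \<le> 4 * (m * d) ^ d * card {Y. card Y = d \<and> robust R D E Y}"
proof -
  define N where "N = card E"
  define I where "I = {..<m}"
  define T where "T = I \<rightarrow>\<^sub>E E"
  define JJ where "JJ = {J. J \<subseteq> I \<and> card J = d}"
  define YY where "YY = {Y. card Y = d \<and> robust R D E Y}"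
  define GA where "GA J = {g. g ` J \<in> YY}" for J :: "nat set"
  define small where "small h J = {X. X \<subseteq> h ` J \<and> D * card (cell R E (h ` J) X) < N}" for h and J :: "nat set"
  define GB where "GB J i = {g. \<exists>X\<in>small g J. g i \<in> cell R E (g ` J) X}" for J i
  define S where "S = {f \<in> T. shatters R (f ` I) d}"
  define S1 where "S1 = (\<Union>J\<in>JJ. {f \<in> T. restrict f J \<in> GA J})"
  define S2 where "S2 = (\<Union>p\<in>(SIGMA J:JJ. I - J). {f \<in> T. restrict f (insert (snd p) (fst p)) \<in> GB (fst p) (snd p)})"
  have N0: "0 < N" using assms by (simp add: N_def card_gt_0_iff)
  have fin: "finite I" "finite T" "finite JJ" "finite YY"
    using assms unfolding I_def T_def JJ_def YY_def robust_def
    by (auto intro!: finite_PiE intro: finite_subset[of _ "Pow E"])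
  have cI: "card I = m" unfolding I_def by simp
  have cJJ: "card JJ \<le> m ^ d"
  proof (cases "d \<le> m")
    case True
    then show ?thesis using n_subsets[OF fin(1), of d] cI binomial_le_pow[OF True] unfolding JJ_def by simp
  next
    case False
    have "JJ = {}" unfolding JJ_def using cI False card_mono[OF fin(1)] by force
    then show ?thesis by simp
  qed
  have JJD: "J \<subseteq> I" "card J = d" "finite J" if "J \<in> JJ" for J
    using that fin(1) unfolding JJ_def by (auto intro: finite_subset)
  have sub: "S \<subseteq> S1 \<union> S2"
  proof
    fix f assume f: "f \<in> S"
    then have fT: "f \<in> T" unfolding S_def by simp
    obtain Y where Y: "Y \<subseteq> f ` I" "card Y = d" "\<forall>X\<subseteq>Y. \<not> cell R (f ` I) Y X \<subseteq> Y"
      using f unfolding S_def shatters_def by blast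
    obtain J where J: "J \<subseteq> I" "inj_on f J" "Y = f ` J" using Y(1) subset_image_inj[of Y f I] by metis
    have cJ: "card J = d" using J Y(2) card_image by fastforce
    then have JJ: "J \<in> JJ" using J unfolding JJ_def by simp
    have fE: "f ` I \<subseteq> E" using fT unfolding T_def by auto
    have res: "restrict f K ` J = f ` J" if "J \<subseteq> K" for K using that by (auto simp: image_iff)
    show "f \<in> S1 \<union> S2"
    proof (cases "robust R D E Y")
      case True
      then have "restrict f J \<in> GA J" using Y J unfolding GA_def YY_def by simp
      then show ?thesis using JJ fT unfolding S1_def by blast
    next
      case False
      then obtain X where X: "X \<subseteq> Y" "D * card (cell R E Y X) < N"
        using Y(1) fE unfolding robust_def N_def by force
      \<comment> \<open>The realising vertex lies outside \<open>Y\<close>, so its index lies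
        outside \<open>J\<close>, and the entry at \<open>i\<close> is independent of the entries
        that form \<open>Y\<close>.\<close>
      obtain i where i: "i \<in> I" "f i \<in> cell R (f ` I) Y X" "f i \<notin> Y"
        using Y(3) X(1) unfolding cell_def by blast
      then have iJ: "i \<notin> J" using J by auto
      have "f i \<in> cell R E Y X" using i fE unfolding cell_def by auto
      then have "restrict f (insert i J) \<in> GB J i"
        using X J res[of "insert i J"] unfolding GB_def small_def by auto
      then show ?thesis using JJ fT i iJ unfolding S2_def by force
    qed
  qed
  have cGA: "card (GA J \<inter> (J \<rightarrow>\<^sub>E E)) \<le> card YY * d ^ d" if "J \<in> JJ" for J
  proof -
    have YYfin: "finite Y \<and> card Y = d" if "Y \<in> YY" for Y
      using that assms(1) unfolding YY_def robust_def by (auto intro: finite_subset)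
    have "GA J \<inter> (J \<rightarrow>\<^sub>E E) \<subseteq> (\<Union>Y\<in>YY. J \<rightarrow>\<^sub>E Y)"
      unfolding GA_def by auto
    then have "card (GA J \<inter> (J \<rightarrow>\<^sub>E E)) \<le> card (\<Union>Y\<in>YY. J \<rightarrow>\<^sub>E Y)"
      using fin(4) YYfin JJD[OF that] by (intro card_mono) (auto intro!: finite_PiE)
    also have "\<dots> \<le> (\<Sum>Y\<in>YY. card (J \<rightarrow>\<^sub>E Y))" by (rule card_UN_le) (rule fin(4))
    also have "\<dots> = (\<Sum>Y\<in>YY. d ^ d)" using JJD[OF that] YYfin by (intro sum.cong) (auto simp: card_PiE)
    finally show ?thesis by simp
  qed
  \<comment> \<open>Once the entries on \<open>J\<close> are fixed, the entry at \<open>i\<close> is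
    confined to at most \<open>2 ^ d\<close> cells, each with fewer than \<open>N / D\<close>
    elements.\<close>
  have cGB: "D * card (GB J i \<inter> (insert i J \<rightarrow>\<^sub>E E)) \<le> N ^ d * (2 ^ d * N)" if "J \<in> JJ" "i \<in> I - J" for J i
  proof -
    define U where "U h = (\<Union>X\<in>small h J. cell R E (h ` J) X)" for h
    have fs: "finite (small h J)" "card (small h J) \<le> 2 ^ d" for h
    proof -
      have "small h J \<subseteq> Pow (h ` J)" unfolding small_def by auto
      moreover have "card (Pow (h ` J)) \<le> 2 ^ d"
        using JJD[OF that(1)] card_image_le[of J h] by (simp add: card_Pow power_increasing)
      ultimately show "finite (small h J)" "card (small h J) \<le> 2 ^ d"
        using JJD[OF that(1)] by (auto intro: finite_subset) (meson card_mono finite_Pow_iff finite_imageI order_trans)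
    qed
    have fc: "finite (cell R E Y X)" for Y X using assms(1) unfolding cell_def by simp
    have fU: "finite (U h)" for h unfolding U_def using fs fc by auto
    have cU: "D * card (U h) \<le> 2 ^ d * N" for h
    proof -
      have "D * card (U h) \<le> D * (\<Sum>X\<in>small h J. card (cell R E (h ` J) X))"
        unfolding U_def by (intro mult_left_mono card_UN_le fs) simp
      also have "\<dots> \<le> (\<Sum>X\<in>small h J. N)"
        unfolding sum_distrib_left by (intro sum_mono) (auto simp: small_def)
      also have "\<dots> \<le> 2 ^ d * N" using fs(2) by simp
      finally show ?thesis .
    qed
    have fJE: "finite (J \<rightarrow>\<^sub>E E)" using JJD[OF that(1)] assms(1) by (auto intro!: finite_PiE)
    have "card (GB J i \<inter> (insert i J \<rightarrow>\<^sub>E E)) \<le> card (SIGMA h:(J \<rightarrow>\<^sub>E E). U h)"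
    proof (rule card_inj_on_le)
      let ?F = "\<lambda>g. (restrict g J, g i)"
      show "inj_on ?F (GB J i \<inter> (insert i J \<rightarrow>\<^sub>E E))"
      proof (rule inj_onI)
        fix g h assume gh: "g \<in> GB J i \<inter> (insert i J \<rightarrow>\<^sub>E E)" "h \<in> GB J i \<inter> (insert i J \<rightarrow>\<^sub>E E)"
          and eq: "(restrict g J, g i) = (restrict h J, h i)"
        show "g = h"
        proof (rule PiE_ext[of g "insert i J" "\<lambda>_. E" h])
          show "g k = h k" if "k \<in> insert i J" for k
            using eq that by (cases "k = i") (auto, metis restrict_apply')
        qed (use gh in auto)
      qed
      have "restrict g J ` J = g ` J" for g :: "nat \<Rightarrow> 'a" by (auto simp: image_iff)
      then have "U (restrict g J) = U g" for g unfolding U_def small_def by simp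
      then show "?F ` (GB J i \<inter> (insert i J \<rightarrow>\<^sub>E E)) \<subseteq> (SIGMA h:(J \<rightarrow>\<^sub>E E). U h)"
        unfolding GB_def U_def by auto
      show "finite (SIGMA h:(J \<rightarrow>\<^sub>E E). U h)" using fJE fU by auto
    qed
    also have "\<dots> = (\<Sum>h\<in>(J \<rightarrow>\<^sub>E E). card (U h))" using fJE fU by simp
    finally have "D * card (GB J i \<inter> (insert i J \<rightarrow>\<^sub>E E)) \<le> (\<Sum>h\<in>(J \<rightarrow>\<^sub>E E). D * card (U h))"
      by (simp add: sum_distrib_left[symmetric])
    also have "\<dots> \<le> (\<Sum>h\<in>(J \<rightarrow>\<^sub>E E). 2 ^ d * N)" by (rule sum_mono) (rule cU)
    also have "\<dots> = N ^ d * (2 ^ d * N)" using JJD[OF that(1)] by (simp add: card_PiE N_def)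
    finally show ?thesis .
  qed
  have dm: "d \<le> m" if "JJ \<noteq> {}"
    using that JJD card_mono[OF fin(1)] cI by (metis all_not_in_conv)
  have c1: "card S1 \<le> m ^ d * (card YY * d ^ d) * N ^ (m - d)"
  proof -
    have "card S1 \<le> (\<Sum>J\<in>JJ. card {f \<in> T. restrict f J \<in> GA J})"
      unfolding S1_def by (rule card_UN_le) (rule fin(3))
    also have "\<dots> \<le> (\<Sum>J\<in>JJ. (card YY * d ^ d) * N ^ (m - d))"
    proof (rule sum_mono)
      fix J assume J: "J \<in> JJ"
      have "card {f \<in> T. restrict f J \<in> GA J} \<le> card (GA J \<inter> (J \<rightarrow>\<^sub>E E)) * card E ^ card (I - J)"
        unfolding T_def using JJD[OF J] fin assms(1) by (intro card_PiE_restrict_le) auto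
      also have "\<dots> \<le> (card YY * d ^ d) * N ^ (m - d)"
        using cGA[OF J] JJD[OF J] cI by (simp add: card_Diff_subset N_def)
      finally show "card {f \<in> T. restrict f J \<in> GA J} \<le> (card YY * d ^ d) * N ^ (m - d)" .
    qed
    also have "\<dots> \<le> m ^ d * ((card YY * d ^ d) * N ^ (m - d))" using cJJ by simp
    finally show ?thesis by (simp add: mult.assoc)
  qed
  \<comment> \<open>Union bound over at most \<open>m ^ d\<close> sets \<open>J\<close> and
    \<open>m\<close> indices \<open>i\<close>. The factor 4 in \<open>D\<close> leaves at most a
    quarter of all tuples in \<open>S2\<close>; as at least half of them shatter a
    \<open>d\<close>-set, at least a quarter remains for \<open>S1\<close>.\<close>
  have c2: "D * card S2 \<le> m ^ d * m * (2 ^ d * N ^ m)"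
  proof -
    let ?P = "SIGMA J:JJ. I - J"
    have fP: "finite ?P" using fin by auto
    have cP: "card ?P \<le> m ^ d * m"
    proof -
      have "card ?P = (\<Sum>J\<in>JJ. card (I - J))" using fin by (simp)
      also have "\<dots> \<le> (\<Sum>J\<in>JJ. m)" using fin(1) cI by (intro sum_mono) (metis card_mono Diff_subset)
      also have "\<dots> \<le> m ^ d * m" using cJJ by simp
      finally show ?thesis .
    qed
    let ?B = "\<lambda>p. {f \<in> T. restrict f (insert (snd p) (fst p)) \<in> GB (fst p) (snd p)}"
    have "card S2 \<le> (\<Sum>p\<in>?P. card (?B p))"
      unfolding S2_def by (rule card_UN_le) (rule fP)
    then have "D * card S2 \<le> (\<Sum>p\<in>?P. D * card (?B p))"
      by (simp add: sum_distrib_left[symmetric])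
    also have "\<dots> \<le> (\<Sum>p\<in>?P. 2 ^ d * N ^ m)"
    proof (rule sum_mono)
      fix p assume "p \<in> ?P"
      then obtain J i where p: "p = (J, i)" and J: "J \<in> JJ" and i: "i \<in> I - J" by auto
      have cJ: "card (insert i J) = d + 1" using JJD[OF J] i by simp
      have le: "d + 1 \<le> m" using card_mono[OF fin(1), of "insert i J"] cJ JJD[OF J] i cI by auto
      have cd: "card (I - insert i J) = m - (d + 1)"
        using cJ JJD[OF J] i cI by (subst card_Diff_subset) auto
      have "card (?B p) \<le> card (GB J i \<inter> (insert i J \<rightarrow>\<^sub>E E)) * card E ^ card (I - insert i J)"
        unfolding p T_def fst_conv snd_conv using JJD[OF J] fin assms(1) i
        by (intro card_PiE_restrict_le) auto
      then have "D * card (?B p) \<le> D * (card (GB J i \<inter> (insert i J \<rightarrow>\<^sub>E E)) * N ^ (m - (d + 1)))"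
        unfolding cd N_def by (rule mult_le_mono2)
      then have "D * card (?B p) \<le> (D * card (GB J i \<inter> (insert i J \<rightarrow>\<^sub>E E))) * N ^ (m - (d + 1))"
        by (simp only: mult.assoc)
      also have "\<dots> \<le> (N ^ d * (2 ^ d * N)) * N ^ (m - (d + 1))"
        using cGB[OF J i] by simp
      also have "\<dots> = 2 ^ d * (N ^ (d + 1) * N ^ (m - (d + 1)))" by simp
      also have "\<dots> = 2 ^ d * N ^ m" unfolding power_add[symmetric] using le by simp
      finally show "D * card (?B p) \<le> 2 ^ d * N ^ m" .
    qed
    also have "\<dots> \<le> m ^ d * m * (2 ^ d * N ^ m)" using cP by simp
    finally show ?thesis .
  qed
  have "(2 ^ d * m ^ (d + 1)) * (4 * card S2) \<le> (2 ^ d * m ^ (d + 1)) * N ^ m"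
    using c2 unfolding D by (simp add: ac_simps)
  then have c2': "4 * card S2 \<le> N ^ m" using assms(3) by simp
  have "card S \<le> card S1 + card S2"
  proof -
    have "S1 \<union> S2 \<subseteq> T" unfolding S1_def S2_def by auto
    then have "card S \<le> card (S1 \<union> S2)" using sub fin(2) by (meson card_mono finite_subset)
    then show ?thesis using card_Un_le[of S1 S2] by linarith
  qed
  moreover have "N ^ m \<le> 2 * card S" using full unfolding full_def S_def T_def I_def N_def .
  ultimately have 3: "N ^ m \<le> 4 * card S1" using c2' by linarith
  then have "S1 \<noteq> {}" using N0 by auto
  then have "JJ \<noteq> {}" unfolding S1_def by auto
  then have "N ^ m = N ^ d * N ^ (m - d)" using dm by (simp add: power_add[symmetric])
  then have "N ^ d * N ^ (m - d) \<le> (4 * (m ^ d * (card YY * d ^ d))) * N ^ (m - d)"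
    using le_trans[OF 3 mult_le_mono2[OF c1, of 4]] by (simp only: mult.assoc)
  then have "N ^ d \<le> 4 * (m ^ d * (card YY * d ^ d))" using N0 by simp
  then show ?thesis unfolding N_def YY_def by (simp add: power_mult_distrib ac_simps)
qed

subsection \<open>Undecided pairs\<close>

text \<open>The class of \<open>r\<close> under equal trace on \<open>Z\<close>. Members of
  \<open>Z\<close> are left out because \<open>shatters\<close> gives no control over the vertices
  of the shattered set itself.\<close>

definition atom :: "('a \<Rightarrow> 'a \<Rightarrow> bool) \<Rightarrow> 'a set \<Rightarrow> 'a set \<Rightarrow> 'a \<Rightarrow> 'a set" where
  "atom R W Z r = {s \<in> W - Z. \<forall>z\<in>Z. R s z = R r z}"

text \<open>These are the vertices whose trace on \<open>Z\<close> does not settle the adjacency to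
  \<open>b\<close>. The vertex \<open>b\<close> itself is disregarded, as \<open>R b b\<close> is
  arbitrary.\<close>

definition undecided :: "('a \<Rightarrow> 'a \<Rightarrow> bool) \<Rightarrow> 'a set \<Rightarrow> 'a set \<Rightarrow> 'a \<Rightarrow> 'a set" where
  "undecided R W Z b = {r \<in> W - Z - {b}. \<not> (\<exists>v. \<forall>s\<in>atom R W Z r - {b}. R s b = v)}"

lemma atom_antimono: "Z \<subseteq> Z' \<Longrightarrow> atom R W Z' r \<subseteq> atom R W Z r"
  unfolding atom_def by auto

lemma undecided_antimono:
  assumes "Z \<subseteq> Z'"
  shows "undecided R W Z' b \<subseteq> undecided R W Z b"
proof
  fix r assume r: "r \<in> undecided R W Z' b"
  have "\<not> (\<exists>v. \<forall>s\<in>atom R W Z r - {b}. R s b = v)"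
    using r atom_antimono[OF assms, of R W r] unfolding undecided_def by blast
  then show "r \<in> undecided R W Z b" using r assms unfolding undecided_def by auto
qed

lemma finite_undecided: "finite W \<Longrightarrow> finite (undecided R W Z b)"
  unfolding undecided_def by simp

text \<open>The set \<open>insert b Y\<close> has \<open>Suc d\<close> elements and is not
  shattered, so for some trace \<open>X\<close> on \<open>Y\<close> all vertices outside
  \<open>insert b Y\<close> with this trace have value \<open>v\<close> towards \<open>b\<close>.
  Adding \<open>Y\<close> to \<open>Z\<close> thus decides the whole cell of \<open>X\<close> in
  \<open>E\<close>, and robustness makes that cell a \<open>1 / D\<close> fraction of
  \<open>E\<close>.\<close>

lemma undecided_step:
  assumes fin: "finite W" and nsh: "\<not> shatters R W (Suc d)" and b: "b \<in> W"
    and E: "E = {r \<in> undecided R W Z b. R r b = v}"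
    and Y: "robust R D E Y" "card Y = d" "D * d < card E"
  shows "card E + D * card (undecided R W (Z \<union> Y) b) \<le> D * card (undecided R W Z b)"
proof -
  have EW: "E \<subseteq> W" "b \<notin> E" "finite E" using E fin unfolding undecided_def by auto
  have YE: "Y \<subseteq> E" "finite Y" "b \<notin> Y" using Y(1) EW unfolding robust_def by (auto intro: finite_subset)
  have cE: "card E \<le> D * card (cell R E Y X)" if "X \<subseteq> Y" for X using Y(1) that unfolding robust_def by auto
  have row: "\<exists>r\<in>cell R E Y X. r \<notin> Y" if X: "X \<subseteq> Y" for X
  proof (rule ccontr)
    assume "\<not> ?thesis"
    then have "card (cell R E Y X) \<le> d" using YE(2) Y(2) by (metis card_mono subsetI)
    then have "D * card (cell R E Y X) \<le> D * d" by (rule mult_le_mono2)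
    then show False using cE[OF X] Y(3) by linarith
  qed
  \<comment> \<open>Otherwise every trace on \<open>Y\<close> extends to \<open>b\<close> both ways: with value \<open>v\<close> by rows from \<open>E\<close>, and with
    value \<open>\<not> v\<close> by the rows that violate the claim.\<close>
  have "\<exists>X\<subseteq>Y. \<forall>r\<in>cell R W Y X - Y - {b}. R r b = v"
  proof (rule ccontr)
    assume "\<not> ?thesis"
    then have other: "\<exists>r\<in>cell R W Y X. r \<notin> Y \<and> r \<noteq> b \<and> R r b \<noteq> v" if "X \<subseteq> Y" for X
      using that by blast
    have "\<not> cell R W (insert b Y) X \<subseteq> insert b Y" if X: "X \<subseteq> insert b Y" for X
    proof -
      have X': "X - {b} \<subseteq> Y" using X by auto
      show ?thesis
      proof (cases "(b \<in> X) = v")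
        case True
        obtain r where r: "r \<in> cell R E Y (X - {b})" "r \<notin> Y" using row[OF X'] by blast
        then have "r \<in> E" unfolding cell_def by simp
        then have "R r b = v" "r \<noteq> b" "r \<in> W" using E EW by auto
        then have "r \<in> cell R W (insert b Y) X" using r(1) True YE(3) unfolding cell_def by auto
        then show ?thesis using r(2) \<open>r \<noteq> b\<close> by blast
      next
        case False
        obtain r where r: "r \<in> cell R W Y (X - {b})" "r \<notin> Y" "r \<noteq> b" "R r b \<noteq> v" using other[OF X'] by blast
        then have "r \<in> cell R W (insert b Y) X" using False YE(3) unfolding cell_def by auto
        then show ?thesis using r by blast
      qed
    qed
    then have "shatters R W (Suc d)"
      unfolding shatters_def using YE EW b Y(2) by (intro exI[of _ "insert b Y"]) auto
    then show False using nsh by simp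
  qed
  then obtain X where X: "X \<subseteq> Y" "\<And>r. r \<in> cell R W Y X \<Longrightarrow> r \<notin> Y \<Longrightarrow> r \<noteq> b \<Longrightarrow> R r b = v" by blast
  have disj: "cell R E Y X \<inter> undecided R W (Z \<union> Y) b = {}"
  proof (rule ccontr)
    assume "\<not> ?thesis"
    then obtain r where r: "r \<in> cell R E Y X" "r \<in> undecided R W (Z \<union> Y) b" by blast
    have "R s b = v" if "s \<in> atom R W (Z \<union> Y) r - {b}" for s
      using that r(1) unfolding atom_def cell_def by (intro X(2)) (auto simp: cell_def)
    then show False using r(2) unfolding undecided_def by auto
  qed
  have "card (cell R E Y X) + card (undecided R W (Z \<union> Y) b) = card (cell R E Y X \<union> undecided R W (Z \<union> Y) b)"
    using disj fin EW(3) by (intro card_Un_disjoint[symmetric]) (auto simp: cell_def finite_undecided)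
  also have "\<dots> \<le> card (undecided R W Z b)"
    using E undecided_antimono[of Z "Z \<union> Y" R W b] finite_undecided[OF fin]
    by (intro card_mono) (auto simp: cell_def)
  finally have "D * card (cell R E Y X) + D * card (undecided R W (Z \<union> Y) b) \<le> D * card (undecided R W Z b)"
    by (metis add_mult_distrib2 mult_le_mono2)
  then show ?thesis using cE[OF X(1)] by linarith
qed

text \<open>For every \<open>b\<close> with many undecided vertices there are many robust \<open>Y\<close>; by averaging, one \<open>Y\<close> serves
  many \<open>b\<close> at once.\<close>

lemma undecided_sum_decrease:
  fixes W :: "'a set"
  defines "w \<equiv> card W" and "\<Phi> \<equiv> \<lambda>R Z. \<Sum>b\<in>W. card (undecided R W Z b)"
  assumes fin: "finite W" and nsh: "\<not> shatters R W (Suc d)" and "0 < m"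
    and full: "\<And>E. E \<subseteq> W \<Longrightarrow> w \<le> 2 * M * card E \<Longrightarrow> full R d m E"
    and D: "D = 4 * 2 ^ d * m ^ (d + 1)" and w: "2 * M * D * d < w"
    and big: "2 * w ^ 2 < M * \<Phi> R Z"
  shows "\<exists>Y\<subseteq>W. card Y = d \<and>
    w ^ 2 + 2 * M ^ 2 * D * (4 * (2 * M * m * d) ^ d) * \<Phi> R (Z \<union> Y)
      \<le> 2 * M ^ 2 * D * (4 * (2 * M * m * d) ^ d) * \<Phi> R Z"
proof -
  \<comment> \<open>The loss in \<open>many_robust\<close>, with the factor
    \<open>(2 * M) ^ d\<close> for passing from \<open>card (E b)\<close> to
    \<open>w\<close>.\<close>
  define Q where "Q = 4 * (2 * M * m * d) ^ d"
  define U where "U Z b = undecided R W Z b" for Z b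
  define B where "B = {b \<in> W. w \<le> M * card (U Z b)}"
  \<comment> \<open>The majority value among the undecided vertices, so that \<open>E b\<close>
    contains at least half of them.\<close>
  define v where "v b \<longleftrightarrow> 2 * card {r \<in> U Z b. R r b} \<ge> card (U Z b)" for b
  define E where "E b = {r \<in> U Z b. R r b = v b}" for b
  define YY where "YY b = {Y. card Y = d \<and> robust R D (E b) Y}" for b
  define P where "P = {Y. Y \<subseteq> W \<and> card Y = d}"
  have finU: "finite (U Z b)" for Z b unfolding U_def by (rule finite_undecided[OF fin])
  have UW: "U Z b \<subseteq> W" for Z b unfolding U_def undecided_def by auto
  have EW: "E b \<subseteq> W" for b using UW unfolding E_def by auto
  have finB: "finite B" "finite P" using fin unfolding B_def P_def by auto
  have half: "card (U Z b) \<le> 2 * card (E b)" for b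
  proof (cases "v b")
    case True
    then show ?thesis unfolding E_def v_def by simp
  next
    case False
    have "card (U Z b) = card {r \<in> U Z b. R r b} + card {r \<in> U Z b. \<not> R r b}"
      using finU by (subst card_Un_disjoint[symmetric]) (auto intro: arg_cong[where f = card])
    then show ?thesis using False unfolding E_def v_def by simp
  qed
  have wE: "w \<le> 2 * M * card (E b)" if "b \<in> B" for b
  proof -
    have "w \<le> M * card (U Z b)" using that unfolding B_def by simp
    also have "\<dots> \<le> M * (2 * card (E b))" using half by (rule mult_le_mono2)
    finally show ?thesis by simp
  qed
  have DE: "D * d < card (E b)" if "b \<in> B" for b
  proof -
    have "2 * M * (D * d) < 2 * M * card (E b)" using wE[OF that] w by (simp only: mult.assoc)
    then show ?thesis by (simp only: mult_less_cancel1)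
  qed
  have many: "w ^ d \<le> Q * card (YY b)" if "b \<in> B" for b
  proof -
    have "full R d m (E b)" using full EW wE[OF that] by blast
    moreover have "E b \<noteq> {}" "finite (E b)" using DE[OF that] by (auto intro: card_ge_0_finite)
    ultimately have "card (E b) ^ d \<le> 4 * (m * d) ^ d * card (YY b)"
      unfolding YY_def using \<open>0 < m\<close> D by (intro many_robust) auto
    then have "(2 * M) ^ d * card (E b) ^ d \<le> (2 * M) ^ d * (4 * (m * d) ^ d * card (YY b))" by (rule mult_le_mono2)
    moreover have "w ^ d \<le> (2 * M) ^ d * card (E b) ^ d"
      unfolding power_mult_distrib[symmetric] using wE[OF that] by (rule power_mono) simp
    moreover have "(2 * M) ^ d * (4 * (m * d) ^ d * card (YY b)) = Q * card (YY b)"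
      unfolding Q_def by (simp add: power_mult_distrib)
    ultimately show ?thesis by linarith
  qed
  have YP: "YY b \<subseteq> P" for b using EW unfolding YY_def P_def robust_def by blast
  have cP: "card P \<le> w ^ d"
  proof (cases "d \<le> w")
    case True
    then show ?thesis using n_subsets[OF fin, of d] binomial_le_pow[OF True] unfolding P_def w_def by simp
  next
    case False
    then have "P = {}" unfolding P_def w_def using card_mono[OF fin] by force
    then show ?thesis by simp
  qed
  define cnt where "cnt Y = card {b \<in> B. Y \<in> YY b}" for Y
  have dc: "(\<Sum>Y\<in>P. cnt Y) = (\<Sum>b\<in>B. card (YY b))"
  proof -
    have "(\<Sum>Y\<in>P. cnt Y) = (\<Sum>Y\<in>P. \<Sum>b\<in>B. if Y \<in> YY b then 1 else 0)"
      unfolding cnt_def using finB by (intro sum.cong refl) (simp add: sum.If_cases Int_def)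
    also have "\<dots> = (\<Sum>b\<in>B. \<Sum>Y\<in>P. if Y \<in> YY b then 1 else 0)" by (rule sum.swap)
    also have "\<dots> = (\<Sum>b\<in>B. card (YY b))"
    proof (rule sum.cong)
      fix b
      have "P \<inter> YY b = YY b" using YP by auto
      then show "(\<Sum>Y\<in>P. if Y \<in> YY b then 1 else 0) = card (YY b)"
        using finB by (simp add: sum.If_cases)
    qed simp
    finally show ?thesis .
  qed
  have w0: "0 < w" using w by simp
  \<comment> \<open>Vertices outside \<open>B\<close> contribute less than \<open>w / M\<close>
    each, hence at most \<open>w ^ 2 / M\<close> altogether. By \<open>big\<close> the vertices in
    \<open>B\<close> contribute more than that, and each of them at most \<open>w\<close>.\<close>
  have cB: "w \<le> M * card B"
  proof -
    have "M * \<Phi> R Z = (\<Sum>b\<in>W. M * card (U Z b))" unfolding \<Phi>_def U_def by (simp add: sum_distrib_left)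
    also have "\<dots> \<le> (\<Sum>b\<in>W. (if b \<in> B then M * w else 0) + w)"
    proof (rule sum_mono)
      fix b assume b: "b \<in> W"
      have "card (U Z b) \<le> w" unfolding w_def using card_mono[OF fin UW] .
      then have "M * card (U Z b) \<le> M * w" by (rule mult_le_mono2)
      then show "M * card (U Z b) \<le> (if b \<in> B then M * w else 0) + w"
      proof (cases "b \<in> B")
        case True
        then show ?thesis using \<open>M * card (U Z b) \<le> M * w\<close> by (simp only: if_True)
      next
        case False
        then show ?thesis using b unfolding B_def by simp
      qed
    qed
    also have "\<dots> = card B * (M * w) + w * w"
    proof -
      have "W \<inter> B = B" unfolding B_def by auto
      then show ?thesis using fin by (simp add: sum.distrib sum.If_cases w_def)
    qed
    finally have "2 * w ^ 2 < card B * (M * w) + w * w" using big by simp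
    then have "w * w < (M * card B) * w" by (simp add: power2_eq_square ac_simps)
    then show ?thesis using w0 by simp
  qed
  have B0: "0 < card B" using cB w0 by (cases "card B") auto
  \<comment> \<open>Averaging: by \<open>many\<close> there are at least
    \<open>card B * w ^ d / Q\<close> pairs of \<open>b\<close> and \<open>Y\<close>, while
    \<open>P\<close> has at most \<open>w ^ d\<close> members.\<close>
  have "\<exists>Y\<in>P. card B \<le> Q * cnt Y"
  proof (rule ccontr)
    assume "\<not> ?thesis"
    then have less: "Q * cnt Y < card B" if "Y \<in> P" for Y using that by force
    have "P \<noteq> {}"
    proof -
      obtain b where b: "b \<in> B" using B0 by (metis card.empty ex_in_conv less_irrefl)
      have "0 < Q * card (YY b)" using many[OF b] w0 by (meson le_less_trans less_le_trans zero_less_power)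
      then show ?thesis using YP[of b] by auto
    qed
    then have "(\<Sum>Y\<in>P. Q * cnt Y) < (\<Sum>Y\<in>P. card B)" using finB less by (intro sum_strict_mono) auto
    then have "Q * (\<Sum>b\<in>B. card (YY b)) < card P * card B" by (simp add: sum_distrib_left[symmetric] dc)
    moreover have "card B * w ^ d \<le> (\<Sum>b\<in>B. Q * card (YY b))"
      using sum_mono[of B "\<lambda>_. w ^ d" "\<lambda>b. Q * card (YY b)"] many by simp
    moreover have "card P * card B \<le> card B * w ^ d" using cP by simp
    ultimately show False by (simp add: sum_distrib_left)
  qed
  then obtain Y where Y: "Y \<in> P" "card B \<le> Q * cnt Y" by blast
  define G where "G = {b \<in> B. Y \<in> YY b}"
  have GW: "G \<subseteq> W" unfolding G_def B_def by auto
  have dec: "w + 2 * M * D * card (U (Z \<union> Y) b) \<le> 2 * M * D * card (U Z b)" if "b \<in> G" for b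
  proof -
    have bB: "b \<in> B" "b \<in> W" "robust R D (E b) Y" "card Y = d" using that unfolding G_def B_def YY_def by auto
    have "card (E b) + D * card (U (Z \<union> Y) b) \<le> D * card (U Z b)"
      unfolding U_def using bB DE[OF bB(1)]
      by (intro undecided_step[OF fin nsh bB(2)]) (auto simp: E_def U_def)
    then have "2 * M * (card (E b) + D * card (U (Z \<union> Y) b)) \<le> 2 * M * (D * card (U Z b))"
      by (rule mult_le_mono2)
    then show ?thesis using wE[OF bB(1)] by (simp add: distrib_left ac_simps)
  qed
  have "card G * w + 2 * M * D * \<Phi> R (Z \<union> Y) = (\<Sum>b\<in>W. (if b \<in> G then w else 0) + 2 * M * D * card (U (Z \<union> Y) b))"
  proof -
    have "W \<inter> G = G" using GW by auto
    then show ?thesis using fin unfolding \<Phi>_def U_def by (simp add: sum.distrib sum.If_cases sum_distrib_left)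
  qed
  also have "\<dots> \<le> (\<Sum>b\<in>W. 2 * M * D * card (U Z b))"
  proof (rule sum_mono)
    fix b
    have "card (U (Z \<union> Y) b) \<le> card (U Z b)" unfolding U_def
      by (intro card_mono finite_undecided[OF fin] undecided_antimono) auto
    then have "2 * M * D * card (U (Z \<union> Y) b) \<le> 2 * M * D * card (U Z b)" by (rule mult_le_mono2)
    then show "(if b \<in> G then w else 0) + 2 * M * D * card (U (Z \<union> Y) b) \<le> 2 * M * D * card (U Z b)"
      using dec by auto
  qed
  also have "\<dots> = 2 * M * D * \<Phi> R Z" unfolding \<Phi>_def U_def by (simp add: sum_distrib_left)
  finally have 1: "card G * w + 2 * M * D * \<Phi> R (Z \<union> Y) \<le> 2 * M * D * \<Phi> R Z" .
  have "w \<le> M * (Q * card G)" using cB Y(2) unfolding cnt_def G_def by (meson le_trans mult_le_mono2)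
  then have "w * w \<le> (M * (Q * card G)) * w" by (rule mult_le_mono1)
  then have 2: "w ^ 2 \<le> M * Q * (card G * w)" by (simp only: mult.assoc power2_eq_square)
  have "M * Q * (card G * w + 2 * M * D * \<Phi> R (Z \<union> Y)) \<le> M * Q * (2 * M * D * \<Phi> R Z)"
    using 1 by (rule mult_le_mono2)
  then have "M * Q * (card G * w) + 2 * M ^ 2 * D * Q * \<Phi> R (Z \<union> Y) \<le> 2 * M ^ 2 * D * Q * \<Phi> R Z"
    by (simp add: power2_eq_square algebra_simps)
  with 2 have "w ^ 2 + 2 * M ^ 2 * D * Q * \<Phi> R (Z \<union> Y) \<le> 2 * M ^ 2 * D * Q * \<Phi> R Z"
    by linarith
  then show ?thesis using Y(1) unfolding P_def Q_def by blast
qed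

text \<open>Iterate \<open>undecided_sum_decrease\<close>. The sum multiplied by the constant
  \<open>P\<close> of the proof starts at most at \<open>P * w ^ 2\<close> and drops by at least
  \<open>w ^ 2\<close> each time, at the price of \<open>d\<close> vertices in \<open>Z\<close>. So
  the threshold is reached within \<open>P + 1\<close> rounds.\<close>

lemma few_undecided:
  fixes W :: "'a set"
  assumes fin: "finite W" and nsh: "\<not> shatters R W (Suc d)" and "0 < m"
    and full: "\<And>E. E \<subseteq> W \<Longrightarrow> card W \<le> 2 * M * card E \<Longrightarrow> full R d m E"
    and D: "D = 4 * 2 ^ d * m ^ (d + 1)" and w: "2 * M * D * d < card W"
  shows "\<exists>Z\<subseteq>W. card Z \<le> d * (2 * M ^ 2 * D * (4 * (2 * M * m * d) ^ d) + 1) \<and>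
    M * (\<Sum>b\<in>W. card (undecided R W Z b)) \<le> 2 * card W ^ 2"
proof -
  define w where "w = card W"
  define \<Phi> where "\<Phi> Z = (\<Sum>b\<in>W. card (undecided R W Z b))" for Z
  define P where "P = 2 * M ^ 2 * D * (4 * (2 * M * m * d) ^ d)"
  have "\<exists>Z\<subseteq>W. card Z \<le> d * j \<and> (M * \<Phi> Z \<le> 2 * w ^ 2 \<or> j * w ^ 2 + P * \<Phi> Z \<le> P * w ^ 2)" for j
  proof (induction j)
    case 0
    have "\<Phi> {} \<le> (\<Sum>b\<in>W. w)" unfolding \<Phi>_def w_def
      by (intro sum_mono card_mono fin) (auto simp: undecided_def)
    then have "\<Phi> {} \<le> w ^ 2" by (simp add: w_def power2_eq_square)
    then show ?case by (intro exI[of _ "{}"]) auto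
  next
    case (Suc j)
    then obtain Z where Z: "Z \<subseteq> W" "card Z \<le> d * j" "M * \<Phi> Z \<le> 2 * w ^ 2 \<or> j * w ^ 2 + P * \<Phi> Z \<le> P * w ^ 2" by blast
    show ?case
    proof (cases "M * \<Phi> Z \<le> 2 * w ^ 2")
      case True
      then show ?thesis using Z by (intro exI[of _ Z]) auto
    next
      case False
      then have "2 * card W ^ 2 < M * (\<Sum>b\<in>W. card (undecided R W Z b))" unfolding \<Phi>_def w_def by simp
      from undecided_sum_decrease[OF fin nsh \<open>0 < m\<close> full D w this]
      obtain Y where Y: "Y \<subseteq> W" "card Y = d" "w ^ 2 + P * \<Phi> (Z \<union> Y) \<le> P * \<Phi> Z"
        unfolding \<Phi>_def w_def P_def by blast
      have "card (Z \<union> Y) \<le> d * Suc j" using card_Un_le[of Z Y] Z(2) Y(2) by simp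
      moreover have "Suc j * w ^ 2 + P * \<Phi> (Z \<union> Y) \<le> P * w ^ 2" using Z(3) False Y(3) by simp
      ultimately show ?thesis using Z(1) Y(1) by (intro exI[of _ "Z \<union> Y"]) auto
    qed
  qed
  from this[of "P + 1"] obtain Z where Z: "Z \<subseteq> W" "card Z \<le> d * (P + 1)"
    "M * \<Phi> Z \<le> 2 * w ^ 2 \<or> (P + 1) * w ^ 2 + P * \<Phi> Z \<le> P * w ^ 2" by blast
  moreover have "0 < w ^ 2" using w unfolding w_def by (cases "card W") auto
  ultimately have "M * \<Phi> Z \<le> 2 * w ^ 2" by auto
  then show ?thesis using Z(1,2) unfolding \<Phi>_def w_def P_def by blast
qed

subsection \<open>Blockades\<close>

definition homogeneous :: "('a \<Rightarrow> 'a \<Rightarrow> bool) \<Rightarrow> bool \<Rightarrow> 'a set \<Rightarrow> bool" where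
  "homogeneous R v H \<longleftrightarrow> (\<forall>x\<in>H. \<forall>y\<in>H. x \<noteq> y \<longrightarrow> R x y = v)"

text \<open>A pure blockade with blocks of relative size at least \<open>1 / k\<close>; one value
  \<open>v\<close> serves all pairs of blocks. The index set consists of vertices because the blocks
  arise from the entries of a tuple.\<close>

definition blockade ::
  "('a \<Rightarrow> 'a \<Rightarrow> bool) \<Rightarrow> 'a set \<Rightarrow> nat \<Rightarrow> bool \<Rightarrow> 'a set \<Rightarrow> ('a \<Rightarrow> 'a set) \<Rightarrow> bool" where
  "blockade R W k v I B \<longleftrightarrow> finite I \<and> (\<forall>t\<in>I. B t \<subseteq> W \<and> card W \<le> k * card (B t)) \<and>
     (\<forall>t\<in>I. \<forall>t'\<in>I. t \<noteq> t' \<longrightarrow> B t \<inter> B t' = {} \<and> (\<forall>x\<in>B t. \<forall>y\<in>B t'. R x y = v))"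

text \<open>Union bound over at most \<open>m ^ 2\<close> ordered pairs of positions, each filled
  from \<open>D\<close> in at most \<open>card (D \<inter> W \<times> W) * card W ^ (m - 2)\<close>
  tuples. So fewer than half of the tuples meet \<open>D\<close>, while at least half satisfy
  \<open>P\<close>.\<close>

lemma tuple_avoiding_pairs:
  assumes fin: "finite W" and "2 \<le> m" and few: "2 * m ^ 2 * card (D \<inter> W \<times> W) < card W ^ 2"
    and P: "card W ^ m \<le> 2 * card {f \<in> {..<m} \<rightarrow>\<^sub>E W. P f}"
  shows "\<exists>f \<in> {..<m} \<rightarrow>\<^sub>E W. P f \<and> (\<forall>i<m. \<forall>j<m. i \<noteq> j \<longrightarrow> (f i, f j) \<notin> D)"
proof (rule ccontr)
  assume not: "\<not> ?thesis"
  define T where "T = {..<m} \<rightarrow>\<^sub>E W"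
  define pairs where "pairs = {p \<in> {..<m} \<times> {..<m}. fst p \<noteq> snd p}"
  define bad where "bad p = {f \<in> T. restrict f {fst p, snd p} \<in> {g. (g (fst p), g (snd p)) \<in> D}}" for p
  have finT: "finite T" unfolding T_def using fin by (intro finite_PiE) auto
  have finp: "finite pairs" unfolding pairs_def by simp
  have cp: "card pairs \<le> m ^ 2"
    using card_mono[of "{..<m} \<times> {..<m}" pairs] unfolding pairs_def by (auto simp: card_cartesian_product power2_eq_square)
  have "{f \<in> T. P f} \<subseteq> (\<Union>p\<in>pairs. bad p)"
  proof
    fix f assume f: "f \<in> {f \<in> T. P f}"
    then obtain i j where "i < m" "j < m" "i \<noteq> j" "(f i, f j) \<in> D" using not unfolding T_def by blast
    then have "(i, j) \<in> pairs" "f \<in> bad (i, j)" using f unfolding pairs_def bad_def by auto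
    then show "f \<in> (\<Union>p\<in>pairs. bad p)" by blast
  qed
  then have "card {f \<in> T. P f} \<le> card (\<Union>p\<in>pairs. bad p)"
    using finT finp unfolding bad_def by (intro card_mono) auto
  also have "\<dots> \<le> (\<Sum>p\<in>pairs. card (bad p))" by (rule card_UN_le) (rule finp)
  also have "\<dots> \<le> (\<Sum>p\<in>pairs. card (D \<inter> W \<times> W) * card W ^ (m - 2))"
  proof (rule sum_mono)
    fix p assume "p \<in> pairs"
    then obtain i j where p: "p = (i, j)" and ij: "i < m" "j < m" "i \<noteq> j" unfolding pairs_def by auto
    define B where "B = {g. (g i, g j) \<in> D}"
    have "card (bad p) \<le> card (B \<inter> ({i, j} \<rightarrow>\<^sub>E W)) * card W ^ card ({..<m} - {i, j})"
      unfolding bad_def T_def p fst_conv snd_conv B_def using ij fin by (intro card_PiE_restrict_le) auto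
    moreover have "card ({..<m} - {i, j}) = m - 2" using ij by (subst card_Diff_subset) auto
    moreover have "card (B \<inter> ({i, j} \<rightarrow>\<^sub>E W)) \<le> card (D \<inter> W \<times> W)"
    proof (rule card_inj_on_le[where f = "\<lambda>g. (g i, g j)"])
      show "inj_on (\<lambda>g. (g i, g j)) (B \<inter> ({i, j} \<rightarrow>\<^sub>E W))"
      proof (rule inj_onI)
        fix g h assume gh: "g \<in> B \<inter> ({i, j} \<rightarrow>\<^sub>E W)" "h \<in> B \<inter> ({i, j} \<rightarrow>\<^sub>E W)" "(g i, g j) = (h i, h j)"
        show "g = h"
          by (rule PiE_ext[of g "{i, j}" "\<lambda>_. W" h]) (use gh in auto)
      qed
      show "(\<lambda>g. (g i, g j)) ` (B \<inter> ({i, j} \<rightarrow>\<^sub>E W)) \<subseteq> D \<inter> W \<times> W" unfolding B_def by auto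
    qed (use fin in simp)
    ultimately show "card (bad p) \<le> card (D \<inter> W \<times> W) * card W ^ (m - 2)"
      by (metis le_trans mult_le_mono1)
  qed
  also have "\<dots> \<le> m ^ 2 * (card (D \<inter> W \<times> W) * card W ^ (m - 2))" using cp by simp
  finally have "2 * card {f \<in> T. P f} \<le> (2 * m ^ 2 * card (D \<inter> W \<times> W)) * card W ^ (m - 2)" by simp
  moreover have "0 < card W ^ (m - 2)" using few by (cases "card W = 0") auto
  ultimately have "2 * card {f \<in> T. P f} < card W ^ 2 * card W ^ (m - 2)"
    using few by (meson le_less_trans mult_less_mono1)
  also have "\<dots> = card W ^ (2 + (m - 2))" by (simp only: power_add)
  also have "2 + (m - 2) = m" using \<open>2 \<le> m\<close> by simp
  finally show False using P unfolding T_def by simp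
qed

text \<open>Atoms correspond to traces on \<open>Z\<close> of vertices outside \<open>Z\<close>. If
  these traces shattered a set of more than \<open>d\<close> elements, then a subset of size
  \<open>Suc d\<close> would be shattered in the sense of \<open>shatters\<close>; so Sauer--Shelah
  applies.\<close>

lemma card_atoms_le:
  assumes fin: "finite W" and "Z \<subseteq> W" and nsh: "\<not> shatters R W (Suc d)"
  shows "card (atom R W Z ` (W - Z)) \<le> (card Z + 1) ^ d"
proof -
  define Fam where "Fam = (\<lambda>r. {z \<in> Z. R r z}) ` (W - Z)"
  have finZ: "finite Z" using assms finite_subset by auto
  have "card Fam \<le> (card Z + 1) ^ d"
  proof (rule sauer_shelah[OF finZ])
    show "Fam \<subseteq> Pow Z" unfolding Fam_def by auto
    fix Y assume Y: "Y \<subseteq> Z" and sh: "\<And>X. X \<subseteq> Y \<Longrightarrow> \<exists>S\<in>Fam. S \<inter> Y = X"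
    show "card Y \<le> d"
    proof (rule ccontr)
      assume "\<not> card Y \<le> d"
      then obtain Y' where Y': "Y' \<subseteq> Y" "card Y' = Suc d"
        by (metis not_less_eq_eq obtain_subset_with_card_n)
      have "\<not> cell R W Y' X \<subseteq> Y'" if X: "X \<subseteq> Y'" for X
      proof -
        obtain r where r: "r \<in> W - Z" "{z \<in> Z. R r z} \<inter> Y = X"
          using sh[of X] X Y' unfolding Fam_def by auto
        have "\<forall>y\<in>Y'. R r y \<longleftrightarrow> y \<in> X" using r(2) Y Y'(1) by blast
        then have "r \<in> cell R W Y' X" using r(1) unfolding cell_def by simp
        then show ?thesis using r(1) Y Y'(1) by blast
      qed
      moreover have "finite Y'" "Y' \<subseteq> W" using Y'(1) Y assms(2) finZ by (auto intro: finite_subset)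
      ultimately show False using nsh Y'(2) unfolding shatters_def by blast
    qed
  qed
  moreover have "card (atom R W Z ` (W - Z)) \<le> card Fam"
  proof -
    have "atom R W Z r = {s \<in> W - Z. {z \<in> Z. R s z} = {z \<in> Z. R r z}}" for r
      unfolding atom_def by blast
    then have "atom R W Z ` (W - Z) = (\<lambda>F. {s \<in> W - Z. {z \<in> Z. R s z} = F}) ` Fam"
      unfolding Fam_def by (simp add: image_image)
    then show ?thesis using fin unfolding Fam_def by (simp add: card_image_le)
  qed
  ultimately show ?thesis by linarith
qed

lemma atom_self: "r \<in> W - Z \<Longrightarrow> r \<in> atom R W Z r"
  unfolding atom_def by simp

lemma atom_eq: "s \<in> atom R W Z r \<Longrightarrow> atom R W Z s = atom R W Z r"
  unfolding atom_def by auto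

lemma atom_subset: "atom R W Z r \<subseteq> W - Z"
  unfolding atom_def by auto

text \<open>Atoms partition \<open>W - Z\<close>, and the vertices in question fill whole atoms.
  Each such atom is less than \<open>k\<close> times as large as its part in \<open>S\<close>; sum
  over these atoms.\<close>

lemma card_dense_atoms_le:
  assumes fin: "finite W"
  shows "card {r \<in> W - Z. card (atom R W Z r) < k * card (atom R W Z r \<inter> S)} \<le> k * card (S \<inter> W)"
proof -
  define G where "G = {r \<in> W - Z. card (atom R W Z r) < k * card (atom R W Z r \<inter> S)}"
  define AA where "AA = atom R W Z ` G"
  have finG: "finite G" "finite AA" unfolding AA_def G_def using fin by auto
  have finA: "finite A" if "A \<in> AA" for A
    using that fin atom_subset[of R W Z] unfolding AA_def by (auto intro: finite_subset)
  have disj: "A \<inter> B = {}" if AB: "A \<in> AA" "B \<in> AA" "A \<noteq> B" for A B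
  proof (rule ccontr)
    assume "A \<inter> B \<noteq> {}"
    then obtain s where "s \<in> A" "s \<in> B" by blast
    moreover obtain r r' where "A = atom R W Z r" "B = atom R W Z r'" using AB unfolding AA_def by blast
    ultimately show False using AB(3) atom_eq by metis
  qed
  have "G \<subseteq> \<Union>AA" unfolding AA_def G_def using atom_self by fastforce
  then have "card G \<le> card (\<Union>AA)" using finG finA by (intro card_mono) auto
  also have "\<dots> \<le> (\<Sum>A\<in>AA. card A)" by (rule card_Union_le_sum_card)
  also have "\<dots> \<le> (\<Sum>A\<in>AA. k * card (A \<inter> S))"
    by (rule sum_mono) (auto simp: AA_def G_def)
  also have "\<dots> = k * (\<Sum>A\<in>AA. card (A \<inter> S))" by (simp add: sum_distrib_left)
  also have "(\<Sum>A\<in>AA. card (A \<inter> S)) = card (\<Union>A\<in>AA. A \<inter> S)"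
    using finG(2) finA disj by (intro card_UN_disjoint[symmetric]) blast+
  also have "k * \<dots> \<le> k * card (S \<inter> W)"
    using fin atom_subset[of R W Z] unfolding AA_def by (intro mult_le_mono2 card_mono) auto
  finally show ?thesis unfolding G_def .
qed

text \<open>The vertices in question lie in at most \<open>L\<close> atoms, each smaller than
  \<open>w / (k * L)\<close>.\<close>

lemma card_small_atoms_le:
  assumes fin: "finite W" and L: "card (atom R W Z ` (W - Z)) \<le> L" "0 < L"
  shows "k * card {r \<in> W - Z. k * L * card (atom R W Z r) < w} \<le> w"
proof -
  define G where "G = {r \<in> W - Z. k * L * card (atom R W Z r) < w}"
  define AA where "AA = atom R W Z ` G"
  have finG: "finite G" "finite AA" unfolding AA_def G_def using fin by auto
  have finA: "finite A" if "A \<in> AA" for A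
    using that fin atom_subset[of R W Z] unfolding AA_def by (auto intro: finite_subset)
  have cA: "card AA \<le> L"
  proof -
    have "card AA \<le> card (atom R W Z ` (W - Z))" unfolding AA_def G_def using fin by (intro card_mono) auto
    then show ?thesis using L by simp
  qed
  have "G \<subseteq> \<Union>AA" unfolding AA_def G_def using atom_self by fastforce
  then have "card G \<le> card (\<Union>AA)" using finG finA by (intro card_mono) auto
  also have "\<dots> \<le> (\<Sum>A\<in>AA. card A)" by (rule card_Union_le_sum_card)
  finally have "k * L * card G \<le> (\<Sum>A\<in>AA. k * L * card A)" by (simp add: sum_distrib_left[symmetric])
  also have "\<dots> \<le> (\<Sum>A\<in>AA. w)" by (rule sum_mono) (auto simp: AA_def G_def)
  also have "\<dots> \<le> L * w" using cA by simp
  finally have "L * (k * card G) \<le> L * w" by (simp add: ac_simps)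
  then show ?thesis using L(2) unfolding G_def by simp
qed

text \<open>Pick a tuple none of whose pairs is exceptional (\<open>D\<close> in the proof) and a homogeneous set \<open>H\<close> of
  \<open>q\<close> entries. Trim the atom of each \<open>t \<in> H\<close> to the vertices \<open>b\<close> for which no other entry of \<open>H\<close> is
  undecided. If two atoms coincide, the trimmed atom is itself homogeneous; otherwise the trimmed atoms
  form a blockade.\<close>

lemma blockade_from_atoms:
  fixes W :: "'a set"
  assumes fin: "finite W" and sym: "\<And>x y. R x y = R y x" and ZW: "Z \<subseteq> W" and m: "2 \<le> m" and qm: "q \<le> m"
    and L: "card (atom R W Z ` (W - Z)) \<le> L" "0 < L"
    and undec: "64 * m ^ 3 * (\<Sum>b\<in>W. card (undecided R W Z b)) \<le> 2 * card W ^ 2"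
    and Z: "16 * m ^ 2 * card Z \<le> card W" and big: "16 * m ^ 2 \<le> card W"
    and rich: "card W ^ m \<le> 2 * card {f \<in> {..<m} \<rightarrow>\<^sub>E W. inj_on f {..<m} \<longrightarrow>
      (\<exists>H\<subseteq>f ` {..<m}. \<exists>v. card H = q \<and> homogeneous R v H)}"
  shows "(\<exists>H\<subseteq>W. \<exists>v. homogeneous R v H \<and> card W \<le> 64 * m ^ 2 * L * card H) \<or>
    (\<exists>I B v. card I = q \<and> blockade R W (64 * m ^ 2 * L) v I B)"
proof -
  define w where "w = card W"
  define A where "A = atom R W Z"
  define U where "U = undecided R W Z"
  define \<Phi> where "\<Phi> = (\<Sum>b\<in>W. card (U b))"
  have w0: "0 < w" using big m unfolding w_def by (metis less_le_trans mult_pos_pos pos2 zero_less_numeral zero_less_power)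
  have UW: "U b \<subseteq> W" for b unfolding U_def undecided_def by auto
  have finU: "finite (U b)" for b using UW fin finite_subset by blast
  have AW: "A r \<subseteq> W - Z" for r unfolding A_def by (rule atom_subset)
  have finA: "finite (A r)" for r using AW fin finite_subset by blast
  \<comment> \<open>\<open>S\<close> consists of \<open>Z\<close> and the vertices in small atoms.
    Avoiding \<open>D1\<close> makes the tuple injective, \<open>D2\<close> keeps its entries out of
    \<open>S\<close>, \<open>D3\<close> makes the entries decided for each other, and
    \<open>D4\<close> makes an entry decided for most of the atom of any other entry.\<close>
  define S where "S = Z \<union> {r \<in> W - Z. 16 * m ^ 2 * L * card (A r) < w}"
  define D1 where "D1 = {(r, r) | r. r \<in> W}"
  define D2 where "D2 = S \<times> W"
  define D3 where "D3 = (SIGMA b:W. U b)"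
  define D4 where "D4 = (SIGMA r:W. {r' \<in> W - Z. card (A r') < 2 * m * card (A r' \<inter> {b. r \<in> U b})})"
  define D where "D = D1 \<union> D2 \<union> D3 \<union> D4"
  have SW: "S \<subseteq> W" using ZW unfolding S_def by auto
  have DW: "D \<subseteq> W \<times> W" using SW UW unfolding D_def D1_def D2_def D3_def D4_def by auto
  have c1: "card D1 \<le> w"
  proof -
    have "D1 = (\<lambda>r. (r, r)) ` W" unfolding D1_def by auto
    then show ?thesis unfolding w_def using card_image_le[OF fin] by metis
  qed
  have cS: "16 * m ^ 2 * card S \<le> 2 * w"
  proof -
    have "card S \<le> card Z + card {r \<in> W - Z. 16 * m ^ 2 * L * card (A r) < w}"
      unfolding S_def by (rule card_Un_le)
    then have "16 * m ^ 2 * card S \<le> 16 * m ^ 2 * card Z + 16 * m ^ 2 * card {r \<in> W - Z. 16 * m ^ 2 * L * card (A r) < w}"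
      unfolding add_mult_distrib2[symmetric] by (rule mult_le_mono2)
    moreover have "16 * m ^ 2 * card {r \<in> W - Z. 16 * m ^ 2 * L * card (A r) < w} \<le> w"
      unfolding A_def by (rule card_small_atoms_le[OF fin L])
    ultimately show ?thesis using Z unfolding w_def by linarith
  qed
  have c2: "16 * m ^ 2 * card D2 \<le> 2 * w ^ 2"
    using mult_le_mono1[OF cS, of w] unfolding D2_def card_cartesian_product w_def
    by (simp only: power2_eq_square mult.assoc)
  have c3: "card D3 = \<Phi>" unfolding D3_def \<Phi>_def using fin finU by simp
  have c4: "card D4 \<le> 2 * m * \<Phi>"
  proof -
    have "card D4 = (\<Sum>r\<in>W. card {r' \<in> W - Z. card (A r') < 2 * m * card (A r' \<inter> {b. r \<in> U b})})"
      unfolding D4_def using fin by simp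
    also have "\<dots> \<le> (\<Sum>r\<in>W. 2 * m * card ({b. r \<in> U b} \<inter> W))"
      unfolding A_def by (intro sum_mono card_dense_atoms_le fin)
    also have "\<dots> = 2 * m * (\<Sum>r\<in>W. card ({b. r \<in> U b} \<inter> W))" by (simp add: sum_distrib_left)
    also have "(\<Sum>r\<in>W. card ({b. r \<in> U b} \<inter> W)) = (\<Sum>r\<in>W. \<Sum>b\<in>W. if r \<in> U b then 1 else 0)"
      using fin by (intro sum.cong refl) (simp add: sum.If_cases Int_commute Int_def)
    also have "\<dots> = (\<Sum>b\<in>W. \<Sum>r\<in>W. if r \<in> U b then 1 else 0)" by (rule sum.swap)
    also have "\<dots> = \<Phi>" unfolding \<Phi>_def
    proof (rule sum.cong)
      fix b
      have "W \<inter> U b = U b" using UW by auto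
      then show "(\<Sum>r\<in>W. if r \<in> U b then 1 else 0) = card (U b)" using fin by (simp add: sum.If_cases)
    qed simp
    finally show ?thesis .
  qed
  \<comment> \<open>After multiplication by \<open>2 * m ^ 2\<close> the sets \<open>D1\<close> to
    \<open>D4\<close> account for at most 1/8, 1/4, 1/16 and 1/8 of \<open>w ^ 2\<close>, which adds
    up to less than the whole.\<close>
  have few: "2 * m ^ 2 * card (D \<inter> W \<times> W) < w ^ 2"
  proof -
    have "card D \<le> card D1 + card D2 + card D3 + card D4"
      unfolding D_def by (meson card_Un_le add_le_mono1 le_trans)
    then have "m ^ 2 * card D \<le> m ^ 2 * (w + card D2 + \<Phi> + 2 * m * \<Phi>)"
      using c1 c3 c4 by (intro mult_le_mono2) linarith
    also have "\<dots> = m ^ 2 * w + m ^ 2 * card D2 + m ^ 2 * \<Phi> + 2 * (m ^ 3 * \<Phi>)"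
      by (simp add: algebra_simps power2_eq_square power3_eq_cube)
    finally have 1: "m ^ 2 * card D \<le> m ^ 2 * w + m ^ 2 * card D2 + m ^ 2 * \<Phi> + 2 * (m ^ 3 * \<Phi>)" .
    have 2: "16 * (m ^ 2 * w) \<le> w ^ 2"
      using mult_le_mono1[OF big, of w] unfolding w_def by (simp only: power2_eq_square mult.assoc)
    have 3: "m ^ 2 * \<Phi> \<le> m ^ 3 * \<Phi>"
      using m by (intro mult_le_mono1 power_increasing) auto
    have 4: "32 * (m ^ 3 * \<Phi>) \<le> w ^ 2" using undec unfolding \<Phi>_def U_def w_def by simp
    have "0 < w ^ 2" using w0 by simp
    moreover have "16 * (m ^ 2 * card D2) \<le> 2 * w ^ 2" using c2 by (simp only: mult.assoc)
    ultimately have "2 * (m ^ 2 * card D) < w ^ 2" using 1 2 3 4 by linarith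
    moreover have "D \<inter> W \<times> W = D" using DW by auto
    ultimately show ?thesis by (simp only: mult.assoc)
  qed
  obtain f where f: "f \<in> {..<m} \<rightarrow>\<^sub>E W"
    and rf: "inj_on f {..<m} \<longrightarrow> (\<exists>H\<subseteq>f ` {..<m}. \<exists>v. card H = q \<and> homogeneous R v H)"
    and av: "\<forall>i<m. \<forall>j<m. i \<noteq> j \<longrightarrow> (f i, f j) \<notin> D"
    using tuple_avoiding_pairs[OF fin m few[unfolded w_def] rich] by blast
  have inj: "inj_on f {..<m}"
  proof (rule inj_onI, rule ccontr)
    fix i j assume ij: "i \<in> {..<m}" "j \<in> {..<m}" "f i = f j" "i \<noteq> j"
    then have "(f i, f j) \<in> D1" using f unfolding D1_def by auto
    then show False using av ij unfolding D_def by auto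
  qed
  define F where "F = f ` {..<m}"
  have FW: "F \<subseteq> W" using f unfolding F_def by auto
  have avF: "(t, t') \<notin> D" if "t \<in> F" "t' \<in> F" "t \<noteq> t'" for t t'
    using that av unfolding F_def by auto
  \<comment> \<open>\<open>D2\<close> is a condition on pairs; it reaches every entry because there
    is a second one, by \<open>2 \<le> m\<close>.\<close>
  have FS: "t \<notin> S" if "t \<in> F" for t
  proof -
    have "2 \<le> card F" unfolding F_def using card_image[OF inj] m by simp
    then have "\<not> F \<subseteq> {t}" using card_mono[of "{t}" F] by auto
    then obtain t' where "t' \<in> F" "t' \<noteq> t" by blast
    then show ?thesis using avF[of t t'] that FW unfolding D_def D2_def by auto
  qed
  obtain H v where H: "H \<subseteq> F" "card H = q" "homogeneous R v H" using rf inj unfolding F_def by blast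
  have finH: "finite H" using H(1) FW fin by (meson finite_subset)
  define B where "B t = {b \<in> A t. \<forall>t'\<in>H - {t}. t' \<notin> U b}" for t
  have tWZ: "t \<in> W - Z" and tA: "t \<in> A t" and wA: "w \<le> 16 * m ^ 2 * L * card (A t)" if "t \<in> H" for t
  proof -
    have "t \<in> F" using that H by auto
    then show 1: "t \<in> W - Z" using FS FW unfolding S_def by auto
    then show "t \<in> A t" unfolding A_def by (rule atom_self)
    show "w \<le> 16 * m ^ 2 * L * card (A t)" using FS[OF \<open>t \<in> F\<close>] 1 unfolding S_def by auto
  qed
  \<comment> \<open>By \<open>D4\<close> each other entry of \<open>H\<close> removes at most a
    \<open>1 / (2 * m)\<close> fraction of the atom, and there are at most \<open>m\<close> of
    them.\<close>
  have halfB: "card (A t) \<le> 2 * card (B t)" if t: "t \<in> H" for t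
  proof -
    have "A t - B t \<subseteq> (\<Union>t'\<in>H - {t}. A t \<inter> {b. t' \<in> U b})" unfolding B_def by auto
    then have "card (A t - B t) \<le> card (\<Union>t'\<in>H - {t}. A t \<inter> {b. t' \<in> U b})"
      using finH finA by (intro card_mono) auto
    also have "\<dots> \<le> (\<Sum>t'\<in>H - {t}. card (A t \<inter> {b. t' \<in> U b}))" by (rule card_UN_le) (use finH in simp)
    finally have "2 * m * card (A t - B t) \<le> (\<Sum>t'\<in>H - {t}. 2 * m * card (A t \<inter> {b. t' \<in> U b}))"
      by (simp only: sum_distrib_left[symmetric] mult_le_mono2)
    also have "\<dots> \<le> (\<Sum>t'\<in>H - {t}. card (A t))"
    proof (rule sum_mono)
      fix t' assume t': "t' \<in> H - {t}"
      then have "(t', t) \<notin> D4" using avF[of t' t] t H(1) unfolding D_def by auto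
      moreover have "t' \<in> W" "t \<in> W - Z" using t' tWZ t by auto
      ultimately show "2 * m * card (A t \<inter> {b. t' \<in> U b}) \<le> card (A t)" unfolding D4_def by auto
    qed
    also have "\<dots> \<le> m * card (A t)"
    proof -
      have "card (H - {t}) \<le> m" using qm H(2) card_mono[OF finH Diff_subset, of "{t}"] by linarith
      then show ?thesis by simp
    qed
    finally have "m * (2 * card (A t - B t)) \<le> m * card (A t)" by (simp add: ac_simps)
    then have "2 * card (A t - B t) \<le> card (A t)" using m by simp
    moreover have "card (A t - B t) = card (A t) - card (B t)" "card (B t) \<le> card (A t)"
      using finA[of t] unfolding B_def by (auto intro!: card_Diff_subset card_mono)
    ultimately show ?thesis by linarith
  qed
  have wB: "w \<le> 32 * m ^ 2 * L * card (B t)" if t: "t \<in> H" for t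
  proof -
    have "16 * m ^ 2 * L * card (A t) \<le> 16 * m ^ 2 * L * (2 * card (B t))" using halfB[OF t] by (rule mult_le_mono2)
    also have "\<dots> = 32 * m ^ 2 * L * card (B t)" by simp
    finally show ?thesis using wA[OF t] by linarith
  qed
  show ?thesis
  proof (cases "\<exists>t\<in>H. \<exists>t'\<in>H. t \<noteq> t' \<and> A t = A t'")
    case True
    then obtain t t' where t: "t \<in> H" "t' \<in> H" "t \<noteq> t'" "A t = A t'" by blast
    \<comment> \<open>For \<open>b\<close> in \<open>C\<close> the vertex \<open>t'\<close> is
      decided, so \<open>R s b\<close> is the same for all \<open>s \<noteq> b\<close> in the common
      atom; by symmetry of \<open>R\<close> these values agree for all \<open>b\<close> in
      \<open>C\<close>. The vertex \<open>t'\<close> is removed because it never counts as undecided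
      for itself.\<close>
    define C where "C = B t - {t'}"
    have val: "\<exists>u. \<forall>s\<in>A t - {b}. R s b = u" if b: "b \<in> C" for b
    proof -
      have "t' \<notin> U b" "t' \<noteq> b" using b t unfolding C_def B_def by auto
      then show ?thesis using tWZ[OF t(2)] t(4) unfolding U_def undecided_def A_def by auto
    qed
    have CA: "C \<subseteq> A t" unfolding C_def B_def by auto
    have hC: "\<exists>u. homogeneous R u C"
    proof (cases "C = {}")
      case True
      then show ?thesis unfolding homogeneous_def by auto
    next
      case False
      obtain g where g: "\<And>b s. b \<in> C \<Longrightarrow> s \<in> A t - {b} \<Longrightarrow> R s b = g b" using val by metis
      obtain x0 where x0: "x0 \<in> C" using False by auto
      have gg: "g x = g y" if "x \<in> C" "y \<in> C" "x \<noteq> y" for x y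
        using g[of x y] g[of y x] that CA sym[of x y] by auto
      have "R x y = g x0" if "x \<in> C" "y \<in> C" "x \<noteq> y" for x y
        using g[of y x] gg[of y x0] that CA x0 by auto
      then show ?thesis unfolding homogeneous_def by blast
    qed
    show ?thesis
    \<comment> \<open>Unless nothing remains, removing \<open>t'\<close> loses at most half of
      \<open>B t\<close>, which turns the factor 32 into 64. If nothing remains, a singleton is
      large enough.\<close>
    proof (cases "C = {}")
      case True
      then have "B t \<subseteq> {t'}" unfolding C_def by auto
      then have "card (B t) \<le> 1" using card_mono[of "{t'}" "B t"] by auto
      then have "32 * m ^ 2 * L * card (B t) \<le> 32 * m ^ 2 * L * 2" by (intro mult_le_mono2) simp
      also have "\<dots> = 64 * m ^ 2 * L * card {t}" by simp
      finally have "w \<le> 64 * m ^ 2 * L * card {t}" using wB[OF t(1)] by linarith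
      moreover have "homogeneous R True {t}" unfolding homogeneous_def by auto
      ultimately show ?thesis using tWZ[OF t(1)] unfolding w_def by blast
    next
      case False
      have finC: "finite C" using CA finA finite_subset by blast
      have "card (B t) \<le> card (insert t' C)" using finC unfolding C_def by (intro card_mono) auto
      also have "\<dots> \<le> card C + 1" using finC by (simp add: card_insert_if)
      also have "\<dots> \<le> 2 * card C" using False finC by (simp add: Suc_leI card_gt_0_iff)
      finally have "32 * m ^ 2 * L * card (B t) \<le> 32 * m ^ 2 * L * (2 * card C)" by (rule mult_le_mono2)
      also have "\<dots> = 64 * m ^ 2 * L * card C" by simp
      finally have "w \<le> 64 * m ^ 2 * L * card C" using wB[OF t(1)] by linarith
      moreover have "C \<subseteq> W" using CA AW by blast
      ultimately show ?thesis using hC unfolding w_def by blast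
    qed
  next
    case False
    have disj: "A t \<inter> A t' = {}" if "t \<in> H" "t' \<in> H" "t \<noteq> t'" for t t'
    proof (rule ccontr)
      assume "A t \<inter> A t' \<noteq> {}"
      then obtain s where "s \<in> A t" "s \<in> A t'" by blast
      then have "A t = A t'" unfolding A_def using atom_eq by metis
      then show False using False that by blast
    qed
    \<comment> \<open>Replace \<open>y\<close> by \<open>t'\<close>, which is decided for
      \<open>x\<close>, and then \<open>x\<close> by \<open>t\<close>, which is decided for
      \<open>t'\<close> by \<open>D3\<close>. What remains is the value \<open>v\<close> on the pair
      \<open>t\<close>, \<open>t'\<close> of \<open>H\<close>.\<close>
    have pure: "R x y = v" if t: "t \<in> H" "t' \<in> H" "t \<noteq> t'" and x: "x \<in> B t" and y: "y \<in> B t'" for t t' x y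
    proof -
      have xA: "x \<in> A t" and yA: "y \<in> A t'" using x y unfolding B_def by auto
      have d: "A t \<inter> A t' = {}" by (rule disj[OF t])
      have "t' \<notin> U x" using x t unfolding B_def by auto
      moreover have "t' \<noteq> x" using d xA tA[OF t(2)] by auto
      ultimately obtain u where u: "\<And>s. s \<in> A t' - {x} \<Longrightarrow> R s x = u"
        using tWZ[OF t(2)] unfolding U_def undecided_def A_def by auto
      have Ryx: "R y x = R t' x" using u[of y] u[of t'] yA tA[OF t(2)] xA d by auto
      have "(t', t) \<notin> D3" using avF[of t' t] t H(1) unfolding D_def by auto
      then have "t \<notin> U t'" using tWZ[OF t(2)] unfolding D3_def by auto
      then obtain u' where u': "\<And>s. s \<in> A t - {t'} \<Longrightarrow> R s t' = u'"
        using tWZ[OF t(1)] t(3) unfolding U_def undecided_def A_def by auto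
      have "R x t' = R t t'" using u'[of x] u'[of t] xA tA[OF t(1)] tA[OF t(2)] d t(3) by auto
      then have "R x t' = v" using H(3) t unfolding homogeneous_def by auto
      then show ?thesis using Ryx sym[of x y] sym[of t' x] by simp
    qed
    have 1: "\<forall>t\<in>H. B t \<subseteq> W \<and> card W \<le> 64 * m ^ 2 * L * card (B t)"
    proof
      fix t assume t: "t \<in> H"
      have "B t \<subseteq> W" using AW[of t] unfolding B_def by auto
      moreover have "w \<le> 64 * m ^ 2 * L * card (B t)" using wB[OF t] by linarith
      ultimately show "B t \<subseteq> W \<and> card W \<le> 64 * m ^ 2 * L * card (B t)" unfolding w_def by simp
    qed
    have "B t \<inter> B t' = {}" if "t \<in> H" "t' \<in> H" "t \<noteq> t'" for t t'
      using disj[OF that] unfolding B_def by auto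
    then have 2: "\<forall>t\<in>H. \<forall>t'\<in>H. t \<noteq> t' \<longrightarrow> B t \<inter> B t' = {} \<and> (\<forall>x\<in>B t. \<forall>y\<in>B t'. R x y = v)"
      using pure by simp
    have "blockade R W (64 * m ^ 2 * L) v H B" using finH 1 2 unfolding blockade_def by simp
    then show ?thesis using H(2) by blast
  qed
qed

subsection \<open>Passing to a larger scale\<close>

text \<open>All parameters of a scale depend polynomially on \<open>m\<close>. From
  \<open>m = 2\<close> on, constant factors can be absorbed into the exponent, so a single power of
  \<open>m\<close> suffices.\<close>

definition poly_bounded :: "(nat \<Rightarrow> nat) \<Rightarrow> bool" where
  "poly_bounded f \<longleftrightarrow> (\<exists>C. \<forall>m\<ge>2. f m \<le> m ^ C)"

lemma poly_bounded_const: "poly_bounded (\<lambda>_. c)"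
proof -
  have "c \<le> m ^ c" if "2 \<le> m" for m :: nat
  proof -
    have "c < 2 ^ c" by (rule less_exp)
    also have "\<dots> \<le> m ^ c" using that by (rule power_mono) simp
    finally show ?thesis by simp
  qed
  then show ?thesis unfolding poly_bounded_def by blast
qed

lemma poly_bounded_id: "poly_bounded (\<lambda>m. m)"
  unfolding poly_bounded_def by (intro exI[of _ 1]) simp

lemma poly_bounded_mult:
  assumes "poly_bounded f" "poly_bounded g"
  shows "poly_bounded (\<lambda>m. f m * g m)"
proof -
  obtain C C' where "\<forall>m\<ge>2. f m \<le> m ^ C" "\<forall>m\<ge>2. g m \<le> m ^ C'" using assms unfolding poly_bounded_def by blast
  then have "\<forall>m\<ge>2. f m * g m \<le> m ^ (C + C')" by (simp add: power_add mult_mono)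
  then show ?thesis unfolding poly_bounded_def by blast
qed

lemma poly_bounded_add:
  assumes "poly_bounded f" "poly_bounded g"
  shows "poly_bounded (\<lambda>m. f m + g m)"
proof -
  obtain C C' where C: "\<forall>m\<ge>2. f m \<le> m ^ C" "\<forall>m\<ge>2. g m \<le> m ^ C'" using assms unfolding poly_bounded_def by blast
  have "f m + g m \<le> m ^ (1 + (C + C'))" if m: "2 \<le> m" for m
  proof -
    have "f m \<le> m ^ (C + C')" "g m \<le> m ^ (C + C')"
      using C m power_increasing[of C "C + C'" m] power_increasing[of C' "C + C'" m] by (auto intro: order_trans)
    then have "f m + g m \<le> 2 * m ^ (C + C')" by simp
    also have "\<dots> \<le> m * m ^ (C + C')" using m by (rule mult_le_mono1)
    finally show ?thesis by simp
  qed
  then show ?thesis unfolding poly_bounded_def by blast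
qed

lemma poly_bounded_power:
  assumes "poly_bounded f"
  shows "poly_bounded (\<lambda>m. f m ^ k)"
  by (induction k) (simp_all add: poly_bounded_const poly_bounded_mult assms)

lemmas poly_bounded_intros =
  poly_bounded_const poly_bounded_id poly_bounded_mult poly_bounded_add poly_bounded_power

text \<open>Tuples with repeated entries count as good: they are few if \<open>W\<close> is large.\<close>

definition rich :: "('a \<Rightarrow> 'a \<Rightarrow> bool) \<Rightarrow> nat \<Rightarrow> nat \<Rightarrow> 'a set \<Rightarrow> bool" where
  "rich R m q W \<longleftrightarrow> card W ^ m \<le> 2 * card {f \<in> {..<m} \<rightarrow>\<^sub>E W. inj_on f {..<m} \<longrightarrow>
      (\<exists>H\<subseteq>f ` {..<m}. \<exists>v. card H = q \<and> homogeneous R v H)}"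

lemma homogeneous_mono: "homogeneous R v H \<Longrightarrow> H' \<subseteq> H \<Longrightarrow> homogeneous R v H'"
  unfolding homogeneous_def by blast

lemma homogeneous_subset_exact:
  assumes "finite F" "H \<subseteq> F" "homogeneous R v H" "q \<le> card H"
  shows "\<exists>H\<subseteq>F. \<exists>v. card H = q \<and> homogeneous R v H"
  using assms by (meson homogeneous_mono obtain_subset_with_card_n order_trans)

text \<open>More than half of the tuples have entries that shatter no \<open>d\<close>-set. If such
  a tuple is injective, its \<open>q ^ \<kappa>\<close> entries contain a homogeneous set of size
  \<open>q\<close> by \<open>EH\<close>.\<close>

lemma rich_of_not_full:
  fixes E :: "'a set"
  assumes EH: "\<And>F. finite F \<Longrightarrow> F \<subseteq> E \<Longrightarrow> \<not> shatters R F d \<Longrightarrow>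
      \<exists>H\<subseteq>F. \<exists>v. homogeneous R v H \<and> card F \<le> card H ^ \<kappa>"
    and "0 < \<kappa>" and m: "m = q ^ \<kappa>" and fin: "finite E" and "\<not> full R d m E"
  shows "rich R m q E"
proof -
  define T where "T = {..<m} \<rightarrow>\<^sub>E E"
  define S where "S = {f \<in> T. shatters R (f ` {..<m}) d}"
  define G where "G = {f \<in> T. inj_on f {..<m} \<longrightarrow> (\<exists>H\<subseteq>f ` {..<m}. \<exists>v. card H = q \<and> homogeneous R v H)}"
  have finT: "finite T" unfolding T_def using fin by (intro finite_PiE) auto
  have cT: "card T = card E ^ m" unfolding T_def by (simp add: card_PiE)
  have "T \<subseteq> S \<union> G"
  proof
    fix f assume f: "f \<in> T"
    show "f \<in> S \<union> G"
    proof (cases "shatters R (f ` {..<m}) d")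
      case False
      have "\<exists>H\<subseteq>f ` {..<m}. \<exists>v. card H = q \<and> homogeneous R v H" if inj: "inj_on f {..<m}"
      proof -
        have "f ` {..<m} \<subseteq> E" using f unfolding T_def by auto
        then obtain H v where H: "H \<subseteq> f ` {..<m}" "homogeneous R v H" "card (f ` {..<m}) \<le> card H ^ \<kappa>"
          using EH[of "f ` {..<m}"] False by auto
        then have "q ^ \<kappa> \<le> card H ^ \<kappa>" using card_image[OF inj] m by simp
        then have "q \<le> card H" using \<open>0 < \<kappa>\<close> by (simp add: power_mono_iff)
        then show ?thesis using H by (intro homogeneous_subset_exact) auto
      qed
      then show ?thesis using f unfolding G_def by simp
    qed (use f in \<open>simp add: S_def\<close>)
  qed
  then have "card T \<le> card (S \<union> G)" using finT unfolding S_def G_def by (intro card_mono) auto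
  then have "card T \<le> card S + card G" using card_Un_le[of S G] by linarith
  moreover have "2 * card S < card E ^ m" using assms(5) unfolding full_def S_def T_def by simp
  ultimately show ?thesis using cT unfolding rich_def G_def T_def by linarith
qed

lemma blockade_mono:
  assumes "blockade R W k v I B" "k \<le> k'"
  shows "blockade R W k' v I B"
proof -
  have "k * c \<le> k' * c" for c using assms(2) by simp
  then have "\<forall>t\<in>I. B t \<subseteq> W \<and> card W \<le> k' * card (B t)"
    using assms(1) order_trans unfolding blockade_def by blast
  then show ?thesis using assms(1) unfolding blockade_def by simp
qed

text \<open>One step through the scales, with \<open>m = q ^ \<kappa>\<close>. If every large
  \<open>E\<close> is full for tuples of length \<open>m ^ 2\<close>, then
  \<open>few_undecided\<close> and \<open>blockade_from_atoms\<close> give one of the last two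
  outcomes. Otherwise some large \<open>E\<close> is not full and is therefore rich at scale
  \<open>q ^ 2\<close>, whose tuples have length \<open>(q ^ 2) ^ \<kappa> = m ^ 2\<close>.\<close>

lemma rich_step:
  fixes d \<kappa> :: nat
  assumes EH: "\<forall>R (F :: 'a set). finite F \<longrightarrow> (\<forall>x y. R x y = R y x) \<longrightarrow> \<not> shatters R F d \<longrightarrow>
      (\<exists>H\<subseteq>F. \<exists>v. homogeneous R v H \<and> card F \<le> card H ^ \<kappa>)"
    and \<kappa>: "0 < \<kappa>"
  shows "\<exists>C>0. \<forall>R (W :: 'a set) q. finite W \<longrightarrow> (\<forall>x y. R x y = R y x) \<longrightarrow> \<not> shatters R W (Suc d) \<longrightarrow> 2 \<le> q \<longrightarrow>
    rich R (q ^ \<kappa>) q W \<longrightarrow> (q ^ \<kappa>) ^ C \<le> card W \<longrightarrow>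
    2 * (q ^ \<kappa>) ^ 2 < card W \<and>
    ((\<exists>E\<subseteq>W. card W \<le> (q ^ \<kappa>) ^ C * card E \<and> rich R ((q ^ 2) ^ \<kappa>) (q ^ 2) E) \<or>
     (\<exists>H\<subseteq>W. \<exists>v. homogeneous R v H \<and> card W \<le> (q ^ \<kappa>) ^ C * card H) \<or>
     (\<exists>I B v. card I = q \<and> blockade R W ((q ^ \<kappa>) ^ C) v I B))"
proof -
  \<comment> \<open>The factor required by \<open>undec\<close> in
    \<open>blockade_from_atoms\<close>. Next, \<open>D\<close> and \<open>\<zeta>\<close> are the
    parameters of \<open>few_undecided\<close> for tuples of length \<open>m ^ 2\<close>, and
    \<open>L\<close> bounds the number of atoms.\<close>
  define M where "M m = 64 * m ^ 3" for m :: nat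
  define D where "D m = 4 * 2 ^ d * (m ^ 2) ^ (d + 1)" for m :: nat
  define \<zeta> where "\<zeta> m = d * (2 * M m ^ 2 * D m * (4 * (2 * M m * m ^ 2 * d) ^ d) + 1)" for m
  define L where "L m = (\<zeta> m + 1) ^ d" for m
  have pM: "poly_bounded M" unfolding M_def by (intro poly_bounded_intros)
  have pD: "poly_bounded D" unfolding D_def by (intro poly_bounded_intros)
  have p\<zeta>: "poly_bounded \<zeta>" unfolding \<zeta>_def by (intro poly_bounded_intros pM pD)
  have pL: "poly_bounded L" unfolding L_def by (intro poly_bounded_intros p\<zeta>)
  \<comment> \<open>The summands are the quantities that \<open>m ^ C\<close> has to dominate, as
    losses or as lower bounds on \<open>card W\<close>; adding them yields one exponent for
    all.\<close>
  have "poly_bounded (\<lambda>m. 2 * M m + (2 * M m * D m * d + 1) + 16 * m ^ 2 * \<zeta> m + 16 * m ^ 2 + 64 * m ^ 2 * L m + 1)"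
    by (intro poly_bounded_intros pM pD p\<zeta> pL)
  then obtain C where C: "\<And>m. 2 \<le> m \<Longrightarrow>
    2 * M m + (2 * M m * D m * d + 1) + 16 * m ^ 2 * \<zeta> m + 16 * m ^ 2 + 64 * m ^ 2 * L m + 1 \<le> m ^ C"
    unfolding poly_bounded_def by blast
  show ?thesis
  proof (intro exI[of _ C] conjI allI impI)
    show "0 < C" using C[of 2] by (cases C) auto
  next
    fix R and W :: "'a set" and q :: nat
    assume fin: "finite W" and sym: "\<forall>x y. R x y = R y x" and nsh: "\<not> shatters R W (Suc d)"
      and q: "2 \<le> q" and rich: "rich R (q ^ \<kappa>) q W" and big: "(q ^ \<kappa>) ^ C \<le> card W"
    define m where "m = q ^ \<kappa>"
    have qm: "q \<le> m" unfolding m_def using q \<kappa> by (intro self_le_power) linarith+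
    have m: "2 \<le> m" using q qm by linarith
    have mC: "m ^ C \<le> card W" using big unfolding m_def .
    note Cm = C[OF m]
    have m2: "(q ^ 2) ^ \<kappa> = m ^ 2" unfolding m_def by (simp add: power_mult[symmetric] mult.commute)
    have large: "2 * m ^ 2 < card W" using Cm mC by linarith
    have "(\<exists>E\<subseteq>W. card W \<le> m ^ C * card E \<and> rich R (m ^ 2) (q ^ 2) E) \<or>
     (\<exists>H\<subseteq>W. \<exists>v. homogeneous R v H \<and> card W \<le> m ^ C * card H) \<or> (\<exists>I B v. card I = q \<and> blockade R W (m ^ C) v I B)"
    proof (cases "\<forall>E\<subseteq>W. card W \<le> 2 * M m * card E \<longrightarrow> full R d (m ^ 2) E")
      case False
      then obtain E where E: "E \<subseteq> W" "card W \<le> 2 * M m * card E" "\<not> full R d (m ^ 2) E" by blast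
      have "rich R (m ^ 2) (q ^ 2) E"
        using E(3) m2 EH sym fin E(1) by (intro rich_of_not_full[OF _ \<kappa>]) (auto intro: finite_subset)
      moreover have "2 * M m * card E \<le> m ^ C * card E" using Cm by (intro mult_le_mono1) linarith
      ultimately show ?thesis using E by (meson order_trans)
    next
      case True
      have "\<exists>Z\<subseteq>W. card Z \<le> d * (2 * M m ^ 2 * D m * (4 * (2 * M m * m ^ 2 * d) ^ d) + 1) \<and>
        M m * (\<Sum>b\<in>W. card (undecided R W Z b)) \<le> 2 * card W ^ 2"
        using True m mC Cm by (intro few_undecided[OF fin nsh]) (auto simp: D_def)
      then obtain Z where Z: "Z \<subseteq> W" "card Z \<le> \<zeta> m"
        "M m * (\<Sum>b\<in>W. card (undecided R W Z b)) \<le> 2 * card W ^ 2" unfolding \<zeta>_def by blast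
      have LZ: "card (atom R W Z ` (W - Z)) \<le> L m"
        using card_atoms_le[OF fin Z(1) nsh] power_mono[of "card Z + 1" "\<zeta> m + 1" d] Z(2) unfolding L_def by linarith
      have "16 * m ^ 2 * card Z \<le> 16 * m ^ 2 * \<zeta> m" using Z(2) by (rule mult_le_mono2)
      then have Zw: "16 * m ^ 2 * card Z \<le> card W" using Cm mC by linarith
      have "16 * m ^ 2 \<le> card W" using Cm mC by linarith
      have sym': "\<And>x y. R x y = R y x" using sym by blast
      have L0: "0 < L m" unfolding L_def by simp
      note bl = blockade_from_atoms[OF fin sym' Z(1) m qm LZ L0 Z(3)[unfolded M_def] Zw \<open>16 * m ^ 2 \<le> card W\<close>
          rich[folded m_def, unfolded rich_def]]
      from bl consider (H) H v where "H \<subseteq> W" "homogeneous R v H" "card W \<le> 64 * m ^ 2 * L m * card H"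
        | (B) I B v where "card I = q" "blockade R W (64 * m ^ 2 * L m) v I B"
        by blast
      then show ?thesis
      proof cases
        case H
        have "64 * m ^ 2 * L m * card H \<le> m ^ C * card H" using Cm by (intro mult_le_mono1) linarith
        then have "card W \<le> m ^ C * card H" using H(3) by linarith
        then show ?thesis using H(1,2) by blast
      next
        case B
        have "64 * m ^ 2 * L m \<le> m ^ C" using Cm by linarith
        then have "blockade R W (m ^ C) v I B" using B(2) blockade_mono by metis
        then show ?thesis using B(1) by blast
      qed
    qed
    then show "(\<exists>E\<subseteq>W. card W \<le> (q ^ \<kappa>) ^ C * card E \<and> rich R ((q ^ 2) ^ \<kappa>) (q ^ 2) E) \<or>
     (\<exists>H\<subseteq>W. \<exists>v. homogeneous R v H \<and> card W \<le> (q ^ \<kappa>) ^ C * card H) \<or>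
     (\<exists>I B v. card I = q \<and> blockade R W ((q ^ \<kappa>) ^ C) v I B)"
      unfolding m2 m_def[symmetric] .
    show "2 * (q ^ \<kappa>) ^ 2 < card W" using large unfolding m_def .
  qed
qed

lemma homogeneous_pair:
  assumes "\<And>x y. R x y = R y x"
  shows "homogeneous R (R x y) {x, y}"
  using assms[of x y] unfolding homogeneous_def by auto

lemma rich_two:
  assumes sym: "\<And>x y. R x y = R y x" and m: "2 \<le> m"
  shows "rich R m 2 W"
proof -
  have "\<exists>H\<subseteq>f ` {..<m}. \<exists>v. card H = 2 \<and> homogeneous R v H" if inj: "inj_on f {..<m}" for f :: "nat \<Rightarrow> 'a"
  proof -
    have "f 0 \<noteq> f 1" using inj_onD[OF inj, of 0 1] m by auto
    then have "card {f 0, f 1} = 2" by simp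
    moreover have "{f 0, f 1} \<subseteq> f ` {..<m}" using m by auto
    ultimately show ?thesis using homogeneous_pair[of R, OF sym] by blast
  qed
  then have "{f \<in> {..<m} \<rightarrow>\<^sub>E W. inj_on f {..<m} \<longrightarrow>
      (\<exists>H\<subseteq>f ` {..<m}. \<exists>v. card H = 2 \<and> homogeneous R v H)} = {..<m} \<rightarrow>\<^sub>E W" by blast
  then show ?thesis unfolding rich_def by (simp add: card_PiE)
qed

text \<open>\<open>tuple_avoiding_pairs\<close> for the diagonal: tuples with repeated entries are
  fewer than half, so some good tuple is injective. This is used when the scale can no longer
  grow.\<close>

lemma rich_imp_homogeneous:
  assumes fin: "finite W" and m: "2 \<le> m" and rich: "rich R m q W" and big: "2 * m ^ 2 < card W"
  shows "\<exists>H\<subseteq>W. \<exists>v. card H = q \<and> homogeneous R v H"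
proof -
  have "card (Id \<inter> W \<times> W) \<le> card W"
    by (rule card_inj_on_le[where f = fst]) (auto simp: inj_on_def fin)
  then have "2 * m ^ 2 * card (Id \<inter> W \<times> W) \<le> 2 * m ^ 2 * card W" by (rule mult_le_mono2)
  also have "\<dots> < card W ^ 2" using big by (simp only: power2_eq_square mult_less_mono1)
  finally have "2 * m ^ 2 * card (Id \<inter> W \<times> W) < card W ^ 2" .
  from tuple_avoiding_pairs[OF fin m this rich[unfolded rich_def]]
  obtain f where f: "f \<in> {..<m} \<rightarrow>\<^sub>E W" "inj_on f {..<m} \<longrightarrow> (\<exists>H\<subseteq>f ` {..<m}. \<exists>v. card H = q \<and> homogeneous R v H)"
    "\<forall>i<m. \<forall>j<m. i \<noteq> j \<longrightarrow> (f i, f j) \<notin> Id" by blast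
  have "inj_on f {..<m}" using f(3) unfolding inj_on_def by auto
  moreover have "f ` {..<m} \<subseteq> W" using f(1) by auto
  ultimately show ?thesis using f(2) by blast
qed

text \<open>Running through the scales \<open>q = 2, 4, 16, \<dots>\<close>, the current set keeps a \<open>1 / q ^ c\<close> fraction of
  all vertices, because the exponents of the successive losses form a geometric series.\<close>

lemma homogeneous_or_blockade:
  fixes d \<kappa> :: nat
  assumes EH: "\<forall>R (F :: 'a set). finite F \<longrightarrow> (\<forall>x y. R x y = R y x) \<longrightarrow> \<not> shatters R F d \<longrightarrow>
      (\<exists>H\<subseteq>F. \<exists>v. homogeneous R v H \<and> card F \<le> card H ^ \<kappa>)"
    and \<kappa>: "0 < \<kappa>"
  shows "\<exists>C. \<forall>R (V :: 'a set). finite V \<longrightarrow> (\<forall>x y. R x y = R y x) \<longrightarrow> \<not> shatters R V (Suc d) \<longrightarrow>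
    2 ^ C \<le> card V \<longrightarrow>
    (\<exists>H\<subseteq>V. \<exists>v. homogeneous R v H \<and> card V \<le> card H ^ C) \<or>
    (\<exists>q\<ge>2. \<exists>I B v. card I = q \<and> blockade R V (q ^ C) v I B)"
proof -
  obtain C0 where "0 < C0" and step: "\<And>R (W :: 'a set) q. finite W \<Longrightarrow> (\<forall>x y. R x y = R y x) \<Longrightarrow> \<not> shatters R W (Suc d) \<Longrightarrow> 2 \<le> q \<Longrightarrow>
    rich R (q ^ \<kappa>) q W \<Longrightarrow> (q ^ \<kappa>) ^ C0 \<le> card W \<Longrightarrow>
    2 * (q ^ \<kappa>) ^ 2 < card W \<and>
    ((\<exists>E\<subseteq>W. card W \<le> (q ^ \<kappa>) ^ C0 * card E \<and> rich R ((q ^ 2) ^ \<kappa>) (q ^ 2) E) \<or>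
     (\<exists>H\<subseteq>W. \<exists>v. homogeneous R v H \<and> card W \<le> (q ^ \<kappa>) ^ C0 * card H) \<or>
     (\<exists>I B v. card I = q \<and> blockade R W ((q ^ \<kappa>) ^ C0) v I B))"
    using rich_step[OF EH \<kappa>] by blast
  define c where "c = \<kappa> * C0"
  \<comment> \<open>\<open>8 * c\<close> serves the case that the next scale is too large, where
    \<open>n < q ^ (8 * c)\<close>; the 2 serves a homogeneous \<open>H\<close> with
    \<open>n \<le> card H ^ 2\<close>.\<close>
  define C where "C = 8 * c + 2"
  have c0: "0 < c" unfolding c_def using \<kappa> \<open>0 < C0\<close> by simp
  have qc: "(q ^ \<kappa>) ^ C0 = q ^ c" for q :: nat unfolding c_def by (simp add: power_mult)
  show ?thesis
  proof (intro exI[of _ C] allI impI)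
    fix R and V :: "'a set"
    assume fin: "finite V" and sym: "\<forall>x y. R x y = R y x" and nsh: "\<not> shatters R V (Suc d)"
      and big: "2 ^ C \<le> card V"
    define n where "n = card V"
    \<comment> \<open>The loss \<open>q ^ c\<close> so far times the loss \<open>q ^ c\<close> at
      this scale is \<open>(q ^ 2) ^ c\<close>, so the invariant reproduces itself at
      \<open>q ^ 2\<close>. The bound on \<open>q ^ (4 * c)\<close> keeps \<open>W\<close> large
      enough for \<open>step\<close>.\<close>
    define state where "state q \<longleftrightarrow> q ^ (4 * c) \<le> n \<and> (\<exists>W\<subseteq>V. n \<le> q ^ c * card W \<and> rich R (q ^ \<kappa>) q W)" for q
    define goal where "goal \<longleftrightarrow> (\<exists>H\<subseteq>V. \<exists>v. homogeneous R v H \<and> card V \<le> card H ^ C) \<or>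
      (\<exists>q\<ge>2. \<exists>I B v. card I = q \<and> blockade R V (q ^ C) v I B)"
    have n0: "0 < n" using big unfolding n_def by (meson less_le_trans pos2 zero_less_power)
    have st: "goal \<or> state (q ^ 2)" if q: "2 \<le> q" and s: "state q" for q
    proof -
      obtain W where W: "W \<subseteq> V" "n \<le> q ^ c * card W" "rich R (q ^ \<kappa>) q W" and qn: "q ^ (4 * c) \<le> n"
        using s unfolding state_def by blast
      have finW: "finite W" using W(1) fin finite_subset by blast
      have nshW: "\<not> shatters R W (Suc d)" using nsh shatters_mono W(1) by metis
      have q0: "0 < q ^ c" using q by simp
      have pw: "q ^ c * q ^ c = q ^ (2 * c)" "q ^ (2 * c) * q ^ (2 * c) = q ^ (4 * c)"
        by (simp_all add: power_add[symmetric] mult_2[symmetric])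
      have "q ^ c * q ^ c \<le> q ^ c * card W"
      proof -
        have "q ^ (2 * c) \<le> q ^ (4 * c)" using q by (intro power_increasing) auto
        then show ?thesis using qn W(2) pw by linarith
      qed
      then have wbig: "(q ^ \<kappa>) ^ C0 \<le> card W" unfolding qc using q0 by (rule mult_left_le_imp_le)
      have nW: "n \<le> q ^ (2 * c) * k" if "card W \<le> q ^ c * k" for k
      proof -
        have "q ^ c * card W \<le> q ^ c * (q ^ c * k)" using that by (rule mult_le_mono2)
        then show ?thesis using W(2) pw(1) by (metis mult.assoc order_trans)
      qed
      note S = step[OF finW sym nshW q W(3) wbig, unfolded qc]
      from S consider (E) E where "E \<subseteq> W" "card W \<le> q ^ c * card E" "rich R ((q ^ 2) ^ \<kappa>) (q ^ 2) E"
        | (H) H v where "H \<subseteq> W" "homogeneous R v H" "card W \<le> q ^ c * card H"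
        | (B) I B v where "card I = q" "blockade R W (q ^ c) v I B" by blast
      then show ?thesis
      proof cases
        case E
        have nE: "n \<le> (q ^ 2) ^ c * card E" using nW[OF E(2)] by (simp add: power_mult)
        show ?thesis
        proof (cases "(q ^ 2) ^ (4 * c) \<le> n")
          case True
          then show ?thesis using E W(1) nE unfolding state_def by blast
        next
          \<comment> \<open>The next scale is out of range, so \<open>q ^ (8 * c)\<close> exceeds
            \<open>n\<close>, and a homogeneous set of \<open>q\<close> vertices in \<open>W\<close>
            suffices.\<close>
          case False
          have "2 \<le> q ^ \<kappa>" using q \<kappa> by (meson order_trans self_le_power one_le_numeral)
          then obtain H v where H: "H \<subseteq> W" "card H = q" "homogeneous R v H"
            using rich_imp_homogeneous[OF finW _ W(3)] S by blast
          have "n \<le> q ^ (8 * c)" using False by (simp add: power_mult[symmetric])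
          also have "\<dots> \<le> q ^ C" unfolding C_def using q by (intro power_increasing) auto
          finally have "card V \<le> card H ^ C" unfolding n_def H(2) .
          then have "\<exists>H\<subseteq>V. \<exists>v. homogeneous R v H \<and> card V \<le> card H ^ C" using H W(1) by blast
          then show ?thesis unfolding goal_def by simp
        qed
      next
        case H
        \<comment> \<open>As \<open>q ^ (4 * c) \<le> n\<close>, the factor
          \<open>q ^ (2 * c)\<close> is at most the square root of \<open>n\<close>, and
          \<open>card H\<close> has to make up for the other square root.\<close>
        have "n \<le> q ^ (2 * c) * card H" using nW[OF H(3)] .
        then have "n * n \<le> (q ^ (2 * c) * card H) * (q ^ (2 * c) * card H)" by (intro mult_le_mono)
        also have "\<dots> = q ^ (4 * c) * card H ^ 2" using pw(2) by (simp add: power2_eq_square mult.assoc mult.left_commute)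
        also have "\<dots> \<le> n * card H ^ 2" using qn by (rule mult_le_mono1)
        finally have nH: "n \<le> card H ^ 2" using n0 by simp
        have "card H \<noteq> 0" using nH n0 by (cases "card H") auto
        then have "card H ^ 2 \<le> card H ^ C" unfolding C_def by (intro power_increasing) auto
        then have "card V \<le> card H ^ C" using nH unfolding n_def by linarith
        then have "\<exists>H\<subseteq>V. \<exists>v. homogeneous R v H \<and> card V \<le> card H ^ C" using H W(1) by blast
        then show ?thesis unfolding goal_def by simp
      next
        case B
        have "q ^ (2 * c) \<le> q ^ C" unfolding C_def using q by (intro power_increasing) auto
        then have le: "q ^ (2 * c) * k \<le> q ^ C * k" for k by (rule mult_le_mono1)
        have "B t \<subseteq> V \<and> card V \<le> q ^ C * card (B t)" if "t \<in> I" for t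
        proof -
          have "B t \<subseteq> W" "card W \<le> q ^ c * card (B t)" using B(2) that unfolding blockade_def by auto
          then show ?thesis using W(1) order_trans[OF nW[of "card (B t)"] le[of "card (B t)"]] unfolding n_def by blast
        qed
        then have "blockade R V (q ^ C) v I B" using B(2) unfolding blockade_def by simp
        then show ?thesis using B(1) q unfolding goal_def by blast
      qed
    qed
    show "(\<exists>H\<subseteq>V. \<exists>v. homogeneous R v H \<and> card V \<le> card H ^ C) \<or>
      (\<exists>q\<ge>2. \<exists>I B v. card I = q \<and> blockade R V (q ^ C) v I B)"
    proof (rule ccontr)
      assume "\<not> ?thesis"
      then have ng: "\<not> goal" unfolding goal_def .
      have two: "2 \<le> (2::nat) ^ 2 ^ j" for j
      proof -
        have "(2::nat) ^ 1 \<le> 2 ^ 2 ^ j" by (intro power_increasing) auto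
        then show ?thesis by simp
      qed
      have "state (2 ^ 2 ^ j)" for j
      proof (induction j)
        case 0
        have "2 \<le> (2::nat) ^ \<kappa>"
          using \<kappa> power_increasing[of 1 \<kappa> "2::nat"] by simp
        then have "rich R (2 ^ \<kappa>) 2 V" using sym by (intro rich_two) auto
        moreover have "n \<le> 2 ^ c * card V" unfolding n_def by simp
        moreover have "(2::nat) ^ (4 * c) \<le> n" using big unfolding n_def C_def
          by (rule order_trans[rotated]) (intro power_increasing, auto)
        ultimately show ?case unfolding state_def by auto
      next
        case (Suc j)
        then have "state ((2 ^ 2 ^ j) ^ 2)" using st[OF two] ng by blast
        then show ?case by (simp add: power_mult[symmetric] mult.commute)
      qed
      then have s: "state (2 ^ 2 ^ n)" .
      have "n < 2 ^ n" by (rule less_exp)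
      also have "(2::nat) ^ n < 2 ^ 2 ^ n" by (intro power_strict_increasing less_exp) auto
      also have "(2::nat) ^ 2 ^ n \<le> (2 ^ 2 ^ n) ^ (4 * c)" using c0 by (intro self_le_power) auto
      also have "\<dots> \<le> n" using s unfolding state_def by simp
      finally show False by simp
    qed
  qed
qed

subsection \<open>Polynomial homogeneous sets\<close>

lemma homogeneous_Union:
  assumes "\<And>t. t \<in> I \<Longrightarrow> homogeneous R v (S t)"
    and "\<And>t t' x y. t \<in> I \<Longrightarrow> t' \<in> I \<Longrightarrow> t \<noteq> t' \<Longrightarrow> x \<in> S t \<Longrightarrow> y \<in> S t' \<Longrightarrow> R x y = v"
  shows "homogeneous R v (\<Union>t\<in>I. S t)"
  unfolding homogeneous_def
proof (intro ballI impI)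
  fix x y assume "x \<in> (\<Union>t\<in>I. S t)" "y \<in> (\<Union>t\<in>I. S t)" "x \<noteq> y"
  then obtain t t' where t: "t \<in> I" "x \<in> S t" "t' \<in> I" "y \<in> S t'" by blast
  show "R x y = v"
  proof (cases "t = t'")
    case True
    then show ?thesis using assms(1)[OF t(1)] t \<open>x \<noteq> y\<close> unfolding homogeneous_def by blast
  next
    case False
    then show ?thesis using assms(2)[OF t(1) t(3) False t(2) t(4)] by simp
  qed
qed

lemma homogeneous_singleton: "homogeneous R v {x}"
  unfolding homogeneous_def by simp

text \<open>Bounding the product of the sizes of a clique and of an independent set makes the induction over
  blockades work: one of the two sizes adds up over the blocks, the other one is at least the maximum.\<close>

lemma homogeneous_product:
  fixes d \<kappa> :: nat
  assumes EH: "\<forall>R (F :: 'a set). finite F \<longrightarrow> (\<forall>x y. R x y = R y x) \<longrightarrow> \<not> shatters R F d \<longrightarrow>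
      (\<exists>H\<subseteq>F. \<exists>v. homogeneous R v H \<and> card F \<le> card H ^ \<kappa>)"
    and \<kappa>: "0 < \<kappa>"
  shows "\<exists>K. \<forall>R (V :: 'a set). finite V \<longrightarrow> (\<forall>x y. R x y = R y x) \<longrightarrow> \<not> shatters R V (Suc d) \<longrightarrow>
    (\<exists>S. (\<forall>v. S v \<subseteq> V \<and> homogeneous R v (S v)) \<and> card V \<le> (card (S True) * card (S False)) ^ K)"
proof -
  obtain K where K: "\<And>R (V :: 'a set). finite V \<Longrightarrow> (\<forall>x y. R x y = R y x) \<Longrightarrow> \<not> shatters R V (Suc d) \<Longrightarrow>
    2 ^ K \<le> card V \<Longrightarrow>
    (\<exists>H\<subseteq>V. \<exists>v. homogeneous R v H \<and> card V \<le> card H ^ K) \<or>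
    (\<exists>q\<ge>2. \<exists>I B v. card I = q \<and> blockade R V (q ^ K) v I B)"
    using homogeneous_or_blockade[OF EH \<kappa>] by blast
  show ?thesis
  proof (intro exI[of _ K] allI impI)
    fix R and V :: "'a set"
    assume "finite V" and sym: "\<forall>x y. R x y = R y x" and "\<not> shatters R V (Suc d)"
    then show "\<exists>S. (\<forall>v. S v \<subseteq> V \<and> homogeneous R v (S v)) \<and> card V \<le> (card (S True) * card (S False)) ^ K"
    proof (induction "card V" arbitrary: V rule: less_induct)
      case less
      note fin = less.prems(1) and nsh = less.prems(3)
      have one: ?case if H: "H \<subseteq> V" "homogeneous R v H" "H \<noteq> {}" "card V \<le> card H ^ K" for H v
      proof -
        obtain h where h: "h \<in> H" using H(3) by blast
        \<comment> \<open>A singleton is homogeneous for both values, so it can stand in for the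
          missing set and contributes a factor 1.\<close>
        define S where "S u = (if u = v then H else {h})" for u
        have "card (S True) * card (S False) = card H" unfolding S_def by (cases v) auto
        moreover have "\<forall>u. S u \<subseteq> V \<and> homogeneous R u (S u)"
          using H h homogeneous_singleton[of R] unfolding S_def by auto
        ultimately show ?thesis using H(4) by (intro exI[of _ S]) simp
      qed
      show ?case
      proof (cases "card V \<le> 1")
        case True
        show ?thesis
        proof (cases "V = {}")
          case True
          then show ?thesis by (intro exI[of _ "\<lambda>_. {}"]) (auto simp: homogeneous_def)
        next
          case False
          then obtain x where "x \<in> V" by blast
          then show ?thesis using True by (intro one[of "{x}" True] homogeneous_singleton) auto
        qed
      next
        case False
        show ?thesis
        proof (cases "2 ^ K \<le> card V")
          case small: False
          obtain x where x: "x \<in> V" using False by fastforce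
          have "\<not> V \<subseteq> {x}" using False card_mono[of "{x}" V] by auto
          then obtain y where y: "y \<in> V" "y \<noteq> x" by blast
          have "homogeneous R (R x y) {x, y}" using sym by (intro homogeneous_pair) auto
          moreover have "card V \<le> card {x, y} ^ K"
          proof -
            have "card {x, y} = 2" using y by simp
            then show ?thesis using small by (simp only: not_le less_imp_le)
          qed
          ultimately show ?thesis using x y by (intro one[of "{x, y}" "R x y"]) auto
        next
          case big: True
          from K[OF fin sym nsh big] consider
            (H) H v where "H \<subseteq> V" "homogeneous R v H" "card V \<le> card H ^ K"
            | (B) q I B v where "2 \<le> q" "card I = q" "blockade R V (q ^ K) v I B" by blast
          then show ?thesis
          proof cases
            case H
            show ?thesis
            proof (cases "H = {}")
              case True
              then have "card V \<le> 0 ^ K" using H(3) by simp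
              moreover have "(0::nat) ^ K \<le> 1" by (cases K) auto
              ultimately show ?thesis using False by linarith
            next
              case False
              then show ?thesis by (rule one[OF H(1,2) _ H(3)])
            qed
          next
            case B
            have finI: "finite I" and BV: "\<And>t. t \<in> I \<Longrightarrow> B t \<subseteq> V" "\<And>t. t \<in> I \<Longrightarrow> card V \<le> q ^ K * card (B t)"
              and disj: "\<And>t t'. t \<in> I \<Longrightarrow> t' \<in> I \<Longrightarrow> t \<noteq> t' \<Longrightarrow> B t \<inter> B t' = {}"
              and pure: "\<And>t t' x y. t \<in> I \<Longrightarrow> t' \<in> I \<Longrightarrow> t \<noteq> t' \<Longrightarrow> x \<in> B t \<Longrightarrow> y \<in> B t' \<Longrightarrow> R x y = v"
              using B(3) unfolding blockade_def by auto
            have finB: "finite (B t)" if "t \<in> I" for t using BV(1)[OF that] fin finite_subset by blast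
            have ne: "B t \<noteq> {}" if "t \<in> I" for t using BV(2)[OF that] False by auto
            have "\<exists>S. (\<forall>u. S u \<subseteq> B t \<and> homogeneous R u (S u)) \<and> card (B t) \<le> (card (S True) * card (S False)) ^ K"
              if t: "t \<in> I" for t
            proof (rule less.hyps)
              have "\<not> I \<subseteq> {t}" using B(1,2) card_mono[of "{t}" I] by auto
              then obtain t' where t': "t' \<in> I" "t' \<noteq> t" by blast
              have "B t \<subset> V" using BV(1)[OF t] BV(1)[OF t'(1)] ne[OF t'(1)] disj[OF t t'(1)] t'(2) by blast
              then show "card (B t) < card V" using fin by (rule psubset_card_mono[rotated])
              show "\<not> shatters R (B t) (Suc d)" using nsh shatters_mono BV(1)[OF t] by metis
            qed (use sym finB t in auto)
            then obtain S where S: "\<And>t u. t \<in> I \<Longrightarrow> S t u \<subseteq> B t" "\<And>t u. t \<in> I \<Longrightarrow> homogeneous R u (S t u)"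
              "\<And>t. t \<in> I \<Longrightarrow> card (B t) \<le> (card (S t True) * card (S t False)) ^ K" by metis
            define p where "p t = card (S t v) * card (S t (\<not> v))" for t
            have Sp: "card (B t) \<le> p t ^ K" if "t \<in> I" for t
              using S(3)[OF that] unfolding p_def by (cases v) (auto simp: mult.commute)
            have Ine: "I \<noteq> {}" using B(1,2) by auto
            \<comment> \<open>\<open>t0\<close> minimises the product and \<open>t1\<close>
              maximises the size of the set for \<open>\<not> v\<close>. The sets for
              \<open>v\<close> are united over all \<open>q\<close> blocks; the factor
              \<open>q\<close> gained in this way, raised to the power \<open>K\<close>, pays for
              the loss \<open>q ^ K\<close> of the blockade.\<close>
            obtain t0 where t0: "t0 \<in> I" "\<And>t. t \<in> I \<Longrightarrow> p t0 \<le> p t"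
            proof -
              have "Min (p ` I) \<in> p ` I" using finI Ine by (intro Min_in) auto
              then obtain t where "t \<in> I" "p t = Min (p ` I)" by auto
              then show ?thesis using that finI by (metis Min_le finite_imageI imageI)
            qed
            obtain t1 where t1: "t1 \<in> I" "\<And>t. t \<in> I \<Longrightarrow> card (S t (\<not> v)) \<le> card (S t1 (\<not> v))"
            proof -
              let ?M = "(\<lambda>t. card (S t (\<not> v))) ` I"
              have "Max ?M \<in> ?M" using finI Ine by (intro Max_in) auto
              then obtain t where "t \<in> I" "card (S t (\<not> v)) = Max ?M" by auto
              then show ?thesis using that finI by (metis Max_ge finite_imageI imageI)
            qed
            define X where "X = (\<Union>t\<in>I. S t v)"
            define T where "T u = (if u = v then X else S t1 (\<not> v))" for u
            have finS: "finite (S t u)" if "t \<in> I" for t u using S(1)[OF that] finB[OF that] finite_subset by blast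
            have cX: "card X = (\<Sum>t\<in>I. card (S t v))"
              unfolding X_def using finI finS
            proof (intro card_UN_disjoint ballI impI)
              fix t t' assume "t \<in> I" "t' \<in> I" "t \<noteq> t'"
              then show "S t v \<inter> S t' v = {}" using disj S(1) by blast
            qed auto
            have hX: "homogeneous R v X" unfolding X_def
            proof (rule homogeneous_Union)
              show "homogeneous R v (S t v)" if "t \<in> I" for t by (rule S(2)[OF that])
              show "R x y = v" if "t \<in> I" "t' \<in> I" "t \<noteq> t'" "x \<in> S t v" "y \<in> S t' v" for t t' x y
                using pure[OF that(1-3)] S(1)[OF that(1), of v] S(1)[OF that(2), of v] that(4,5) by blast
            qed
            have XV: "X \<subseteq> V" "S t1 (\<not> v) \<subseteq> V"
              unfolding X_def using S(1) BV(1) t1(1) by blast+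
            have T: "\<forall>u. T u \<subseteq> V \<and> homogeneous R u (T u)"
              unfolding T_def using hX XV S(2)[OF t1(1)] by (cases v) auto
            have "q * p t0 = (\<Sum>t\<in>I. p t0)" using B(2) by simp
            also have "\<dots> \<le> (\<Sum>t\<in>I. card (S t v) * card (S t1 (\<not> v)))"
            proof (rule sum_mono)
              fix t assume t: "t \<in> I"
              have "p t0 \<le> p t" by (rule t0(2)[OF t])
              also have "\<dots> \<le> card (S t v) * card (S t1 (\<not> v))" unfolding p_def by (intro mult_le_mono2 t1(2)[OF t])
              finally show "p t0 \<le> card (S t v) * card (S t1 (\<not> v))" .
            qed
            also have "\<dots> = card X * card (S t1 (\<not> v))" unfolding cX by (simp add: sum_distrib_right)
            also have "\<dots> = card (T True) * card (T False)" unfolding T_def by (cases v) auto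
            finally have qp: "q * p t0 \<le> card (T True) * card (T False)" .
            have "card V \<le> q ^ K * card (B t0)" by (rule BV(2)[OF t0(1)])
            also have "\<dots> \<le> q ^ K * p t0 ^ K" by (intro mult_le_mono2 Sp t0(1))
            also have "\<dots> = (q * p t0) ^ K" by (simp add: power_mult_distrib)
            also have "\<dots> \<le> (card (T True) * card (T False)) ^ K" using qp by (intro power_mono) auto
            finally show ?thesis using T by (intro exI[of _ T]) simp
          qed
        qed
      qed
    qed
  qed
qed

text \<open>Induction on \<open>d\<close>. A nonempty set shatters the empty set, which settles
  \<open>d = 0\<close>. In the step, the larger of the two sets from
  \<open>homogeneous_product\<close> has at least the square root of the product as its size, whence
  the exponent \<open>2 * K\<close>; one more keeps it positive.\<close>

theorem polynomial_homogeneous_set: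
  "\<exists>\<kappa>>0. \<forall>R (F :: 'a set). finite F \<longrightarrow> (\<forall>x y. R x y = R y x) \<longrightarrow> \<not> shatters R F d \<longrightarrow>
      (\<exists>H\<subseteq>F. \<exists>v. homogeneous R v H \<and> card F \<le> card H ^ \<kappa>)"
proof (induction d)
  case 0
  have "F = {}" if "\<not> shatters R F 0" for R and F :: "'a set"
  proof (rule ccontr)
    assume "F \<noteq> {}"
    then have "shatters R F 0" unfolding shatters_def cell_def by (intro exI[of _ "{}"]) auto
    then show False using that by simp
  qed
  then show ?case by (intro exI[of _ 1]) (auto simp: homogeneous_def)
next
  case (Suc d)
  then obtain \<kappa> where "0 < \<kappa>" and EH: "\<forall>R (F :: 'a set). finite F \<longrightarrow> (\<forall>x y. R x y = R y x) \<longrightarrow> \<not> shatters R F d \<longrightarrow>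
      (\<exists>H\<subseteq>F. \<exists>v. homogeneous R v H \<and> card F \<le> card H ^ \<kappa>)" by blast
  obtain K where K: "\<And>R (V :: 'a set). finite V \<Longrightarrow> (\<forall>x y. R x y = R y x) \<Longrightarrow> \<not> shatters R V (Suc d) \<Longrightarrow>
    \<exists>S. (\<forall>v. S v \<subseteq> V \<and> homogeneous R v (S v)) \<and> card V \<le> (card (S True) * card (S False)) ^ K"
    using homogeneous_product[OF EH \<open>0 < \<kappa>\<close>] by blast
  show ?case
  proof (intro exI[of _ "2 * K + 1"] conjI allI impI)
    fix R and F :: "'a set"
    assume F: "finite F" "\<forall>x y. R x y = R y x" "\<not> shatters R F (Suc d)"
    obtain S where S: "\<forall>v. S v \<subseteq> F \<and> homogeneous R v (S v)" "card F \<le> (card (S True) * card (S False)) ^ K"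
      using K[OF F] by blast
    obtain v where v: "card (S u) \<le> card (S v)" for u
      by (cases "card (S True) \<le> card (S False)") (metis (full_types) order_refl linear)+
    have "card F \<le> (card (S v) * card (S v)) ^ K"
      using S(2) v by (meson mult_le_mono order_trans power_mono zero_le)
    also have "\<dots> = card (S v) ^ (2 * K)" by (simp add: power_mult power2_eq_square)
    finally have 1: "card F \<le> card (S v) ^ (2 * K)" .
    show "\<exists>H\<subseteq>F. \<exists>v. homogeneous R v H \<and> card F \<le> card H ^ (2 * K + 1)"
    proof (cases "F = {}")
      case True
      then show ?thesis by (auto simp: homogeneous_def)
    next
      case False
      then obtain x where x: "x \<in> F" by blast
      show ?thesis
      proof (cases "card (S v) = 0")
        case True
        then have "card F \<le> 1" using 1 by (cases K) auto
        then show ?thesis using x homogeneous_singleton[of R True x] by (intro exI[of _ "{x}"]) auto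
      next
        case False
        then have "card (S v) ^ (2 * K) \<le> card (S v) ^ (2 * K + 1)" by (intro power_increasing) auto
        then have "card F \<le> card (S v) ^ (2 * K + 1)" using 1 by linarith
        then show ?thesis using S(1) by blast
      qed
    qed
  qed simp
qed

subsection \<open>From graphs to matrices\<close>

text \<open>With \<open>D + 1 = 2 ^ e\<close> the claim becomes \<open>e * k < 2 ^ e - 1\<close>,
  and \<open>e = 4 * k + 4\<close> works because \<open>2 ^ e\<close> is at least the square of
  \<open>2 * k + 3\<close>.\<close>

lemma exists_power_less_exp: "\<exists>D. (D + 1) ^ k < (2::nat) ^ D"
proof -
  define e where "e = 4 * k + 4"
  have "2 * k + 2 < 2 ^ (2 * k + 2)" by (rule less_exp)
  then have "(2 * k + 3) * (2 * k + 3) \<le> 2 ^ (2 * k + 2) * 2 ^ (2 * k + 2)" by (intro mult_le_mono) auto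
  also have "\<dots> = (2::nat) ^ (2 * k + 2 + (2 * k + 2))" by (simp only: power_add)
  also have "2 * k + 2 + (2 * k + 2) = e" unfolding e_def by simp
  finally have "e * k + 1 < 2 ^ e" unfolding e_def by (simp add: algebra_simps)
  then have "(2::nat) ^ (e * k) < 2 ^ (2 ^ e - 1)" by (intro power_strict_increasing) auto
  then have "((2 ^ e - 1) + 1) ^ k < (2::nat) ^ (2 ^ e - 1)" by (simp add: power_mult)
  then show ?thesis by blast
qed

text \<open>A trace of this graph on \<open>Y\<close> is determined by a trace of \<open>Q\<close>, a trace of its transpose, and the
  position of the vertex relative to \<open>Y\<close>.\<close>

lemma min_max_not_shatters:
  fixes Q :: "'a::linorder \<Rightarrow> 'a \<Rightarrow> bool"
  assumes fin: "finite F"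
    and col: "\<And>Y. Y \<subseteq> F \<Longrightarrow> card ((\<lambda>r. {y \<in> Y. Q y r}) ` F) \<le> (card Y + 1) ^ d"
    and row: "\<And>Y. Y \<subseteq> F \<Longrightarrow> card ((\<lambda>r. {y \<in> Y. Q r y}) ` F) \<le> (card Y + 1) ^ d"
    and D: "(D + 1) ^ (2 * d + 1) < 2 ^ D"
  shows "\<not> shatters (\<lambda>x y. Q (min x y) (max x y)) F D"
proof
  assume "shatters (\<lambda>x y. Q (min x y) (max x y)) F D"
  then obtain Y where Y: "Y \<subseteq> F" "finite Y" "card Y = D"
    "\<forall>X\<subseteq>Y. \<not> cell (\<lambda>x y. Q (min x y) (max x y)) F Y X \<subseteq> Y" unfolding shatters_def by blast
  define P0 where "P0 = (\<lambda>r. {y \<in> Y. y < r}) ` F"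
  define P1 where "P1 = (\<lambda>r. {y \<in> Y. Q y r}) ` F"
  define P2 where "P2 = (\<lambda>r. {y \<in> Y. Q r y}) ` F"
  have finP: "finite P0" "finite P1" "finite P2" unfolding P0_def P1_def P2_def using fin by auto
  \<comment> \<open>The initial segments of \<open>Y\<close> form a chain, so each is determined by
    its size.\<close>
  have "card P0 \<le> card {0..D}"
  proof (rule card_inj_on_le[where f = card])
    show "inj_on card P0"
    proof (rule inj_onI)
      fix S S' assume "S \<in> P0" "S' \<in> P0" "card S = card S'"
      then obtain r r' where r: "S = {y \<in> Y. y < r}" "S' = {y \<in> Y. y < r'}" unfolding P0_def by auto
      have "finite S" "finite S'" using r Y(2) by auto
      show "S = S'"
      proof (cases "r \<le> r'")
        case True
        then have "S \<subseteq> S'" using r by auto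
        then show ?thesis using \<open>finite S'\<close> \<open>card S = card S'\<close> by (metis card_subset_eq)
      next
        case False
        then have "S' \<subseteq> S" using r by auto
        then show ?thesis using \<open>finite S\<close> \<open>card S = card S'\<close> by (metis card_subset_eq)
      qed
    qed
    show "card ` P0 \<subseteq> {0..D}" unfolding P0_def using Y(2,3) by (auto intro!: card_mono)
  qed simp
  then have c0: "card P0 \<le> D + 1" by simp
  have c1: "card P1 \<le> (D + 1) ^ d" "card P2 \<le> (D + 1) ^ d"
    using col[OF Y(1)] row[OF Y(1)] Y(3) unfolding P1_def P2_def by auto
  have "Pow Y \<subseteq> (\<lambda>(S, T, U). (S \<inter> T) \<union> (U - S)) ` (P0 \<times> P1 \<times> P2)"
  proof
    fix X assume "X \<in> Pow Y"
    then have X: "X \<subseteq> Y" by simp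
    obtain r where r: "r \<in> F" "\<forall>y\<in>Y. Q (min r y) (max r y) \<longleftrightarrow> y \<in> X" "r \<notin> Y"
      using Y(4) X unfolding cell_def by blast
    let ?S = "{y \<in> Y. y < r}" and ?T = "{y \<in> Y. Q y r}" and ?U = "{y \<in> Y. Q r y}"
    have eq: "y \<in> X \<longleftrightarrow> (y < r \<and> Q y r \<or> \<not> y < r \<and> Q r y)" if "y \<in> Y" for y
    proof -
      have "Q (min r y) (max r y) \<longleftrightarrow> y \<in> X" using r(2) that by simp
      moreover have "min r y = (if y < r then y else r)" "max r y = (if y < r then r else y)" by auto
      ultimately show ?thesis by (cases "y < r") simp_all
    qed
    have "X = (?S \<inter> ?T) \<union> (?U - ?S)"
    proof (rule Set.set_eqI)
      fix y
      show "y \<in> X \<longleftrightarrow> y \<in> (?S \<inter> ?T) \<union> (?U - ?S)" using X eq[of y] by (cases "y \<in> Y") auto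
    qed
    moreover have "(?S, ?T, ?U) \<in> P0 \<times> P1 \<times> P2" using r(1) unfolding P0_def P1_def P2_def by blast
    ultimately show "X \<in> (\<lambda>(S, T, U). (S \<inter> T) \<union> (U - S)) ` (P0 \<times> P1 \<times> P2)"
      by (intro image_eqI[where x = "(?S, ?T, ?U)"]) simp_all
  qed
  then have "card (Pow Y) \<le> card (P0 \<times> P1 \<times> P2)" using finP by (intro surj_card_le) auto
  then have "2 ^ D \<le> card P0 * (card P1 * card P2)" using Y(2,3) by (simp add: card_Pow card_cartesian_product)
  also have "\<dots> \<le> (D + 1) * ((D + 1) ^ d * (D + 1) ^ d)" using c0 c1 by (intro mult_le_mono)
  also have "\<dots> = (D + 1) ^ (2 * d + 1)" by (simp add: power_add mult_2)
  finally show False using D by simp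
qed

text \<open>The parts of \<open>Q\<close> above and below the diagonal become two symmetric graphs
  \<open>G1\<close> and \<open>G2\<close>. The graph theorem is applied to \<open>G1\<close>, and
  then to \<open>G2\<close> inside the set obtained, so the exponents multiply.\<close>

lemma ordered_homogeneous_set:
  "\<exists>\<kappa>. \<forall>(Q :: 'a::linorder \<Rightarrow> 'a \<Rightarrow> bool) F. finite F \<longrightarrow>
    (\<forall>Y\<subseteq>F. card ((\<lambda>r. {y \<in> Y. Q y r}) ` F) \<le> (card Y + 1) ^ d) \<longrightarrow>
    (\<forall>Y\<subseteq>F. card ((\<lambda>r. {y \<in> Y. Q r y}) ` F) \<le> (card Y + 1) ^ d) \<longrightarrow>
    (\<exists>H\<subseteq>F. \<exists>\<alpha> \<gamma>. (\<forall>i\<in>H. \<forall>j\<in>H. i < j \<longrightarrow> Q i j = \<alpha> \<and> Q j i = \<gamma>) \<and> card F \<le> card H ^ \<kappa>)"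
proof -
  obtain D where D: "(D + 1) ^ (2 * d + 1) < (2::nat) ^ D" using exists_power_less_exp by blast
  obtain \<kappa> where "0 < \<kappa>" and EH: "\<And>R (F :: 'a set). finite F \<Longrightarrow> \<forall>x y. R x y = R y x \<Longrightarrow> \<not> shatters R F D \<Longrightarrow>
      \<exists>H\<subseteq>F. \<exists>v. homogeneous R v H \<and> card F \<le> card H ^ \<kappa>"
    using polynomial_homogeneous_set[where 'a = 'a and d = D] by blast
  show ?thesis
  proof (intro exI[of _ "\<kappa> * \<kappa>"] allI impI)
    fix Q :: "'a \<Rightarrow> 'a \<Rightarrow> bool" and F
    assume fin: "finite F"
      and col: "\<forall>Y\<subseteq>F. card ((\<lambda>r. {y \<in> Y. Q y r}) ` F) \<le> (card Y + 1) ^ d"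
      and row: "\<forall>Y\<subseteq>F. card ((\<lambda>r. {y \<in> Y. Q r y}) ` F) \<le> (card Y + 1) ^ d"
    define G1 where "G1 x y = Q (min x y) (max x y)" for x y
    define G2 where "G2 x y = Q (max x y) (min x y)" for x y
    have n1: "\<not> shatters G1 F D"
      unfolding G1_def using fin col row D by (intro min_max_not_shatters) auto
    have n2: "\<not> shatters G2 F D"
      unfolding G2_def using fin col row D by (intro min_max_not_shatters[where Q = "\<lambda>x y. Q y x"]) auto
    have s1: "\<forall>x y. G1 x y = G1 y x" and s2: "\<forall>x y. G2 x y = G2 y x"
      unfolding G1_def G2_def by (simp_all add: min.commute max.commute)
    obtain H1 \<alpha> where H1: "H1 \<subseteq> F" "homogeneous G1 \<alpha> H1" "card F \<le> card H1 ^ \<kappa>"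
      using EH[OF fin s1 n1] by blast
    have "\<not> shatters G2 H1 D" "finite H1" using n2 shatters_mono H1(1) fin finite_subset by blast+
    then obtain H \<gamma> where H: "H \<subseteq> H1" "homogeneous G2 \<gamma> H" "card H1 \<le> card H ^ \<kappa>"
      using EH[OF _ s2] by blast
    have "Q i j = \<alpha> \<and> Q j i = \<gamma>" if "i \<in> H" "j \<in> H" "i < j" for i j
    proof -
      have "i \<in> H1" "j \<in> H1" "i \<noteq> j" using that H(1) by auto
      then have "G1 i j = \<alpha>" "G2 i j = \<gamma>"
        using H1(2) H(2) that(1,2) unfolding homogeneous_def by simp_all
      moreover have "min i j = i" "max i j = j" using that(3) by auto
      ultimately show ?thesis unfolding G1_def G2_def by simp
    qed
    moreover have "card F \<le> card H ^ (\<kappa> * \<kappa>)"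
      using H1(3) power_mono[OF H(3), of \<kappa>] by (simp add: power_mult)
    ultimately show "\<exists>H\<subseteq>F. \<exists>\<alpha> \<gamma>. (\<forall>i\<in>H. \<forall>j\<in>H. i < j \<longrightarrow> Q i j = \<alpha> \<and> Q j i = \<gamma>) \<and> card F \<le> card H ^ (\<kappa> * \<kappa>)"
      using H(1) H1(1) by (intro exI[of _ H] exI[of _ \<alpha>] exI[of _ \<gamma>]) auto
  qed
qed

lemma card_traces_le_vc_dim:
  assumes vc: "vc_dim (X, Fam) \<le> enat d" and Y: "Y \<subseteq> X" "finite Y"
  shows "card ((\<lambda>T. Y \<inter> T) ` Fam) \<le> (card Y + 1) ^ d"
proof (rule sauer_shelah[OF Y(2)])
  show "(\<lambda>T. Y \<inter> T) ` Fam \<subseteq> Pow Y" by auto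
  fix Y' assume Y': "Y' \<subseteq> Y" and sh: "\<And>X. X \<subseteq> Y' \<Longrightarrow> \<exists>S\<in>(\<lambda>T. Y \<inter> T) ` Fam. S \<inter> Y' = X"
  have fin: "finite Y'" using Y' Y(2) finite_subset by blast
  have "{Y' \<inter> T | T. T \<in> Fam} = Pow Y'"
  proof
    show "Pow Y' \<subseteq> {Y' \<inter> T | T. T \<in> Fam}"
    proof
      fix X assume "X \<in> Pow Y'"
      then obtain T where "T \<in> Fam" "(Y \<inter> T) \<inter> Y' = X" using sh[of X] by auto
      then show "X \<in> {Y' \<inter> T | T. T \<in> Fam}" using Y' by blast
    qed
  qed auto
  then have "shattered (X, Fam) Y'" unfolding shattered_def using Y' Y(1) fin by (simp add: card_Pow)
  then have "enat (card Y') \<le> vc_dim (X, Fam)" unfolding vc_dim_def by (intro SUP_upper) simp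
  then have "enat (card Y') \<le> enat d" using vc by (rule order_trans)
  then show "card Y' \<le> d" by simp
qed

text \<open>Take \<open>F\<close> as small as possible. Without \<open>r \<in> F\<close> two columns
  coincide on the remaining rows of \<open>F\<close>; within \<open>F\<close> they differ in row
  \<open>r\<close> alone, and \<open>c r v\<close> is the one with entry \<open>v\<close>
  there.\<close>

lemma separating_rows:
  fixes A :: "bool mat"
  assumes "distinct (cols A)"
  shows "\<exists>F\<subseteq>{..<dim_row A}. inj_on (\<lambda>j. {r \<in> F. A $$ (r, j)}) {..<dim_col A} \<and>
    (\<exists>c. \<forall>r\<in>F. \<forall>v. c r v < dim_col A \<and> A $$ (r, c r v) = v \<and>
      (\<forall>s\<in>F - {r}. \<forall>v'. A $$ (s, c r v) = A $$ (s, c r v')))"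
proof -
  define P where "P F \<longleftrightarrow> F \<subseteq> {..<dim_row A} \<and> inj_on (\<lambda>j. {r \<in> F. A $$ (r, j)}) {..<dim_col A}" for F
  have "P {..<dim_row A}" unfolding P_def
  proof (intro conjI inj_onI)
    fix i j assume ij: "i \<in> {..<dim_col A}" "j \<in> {..<dim_col A}"
      and eq: "{r \<in> {..<dim_row A}. A $$ (r, i)} = {r \<in> {..<dim_row A}. A $$ (r, j)}"
    have "col A i = col A j"
    proof (rule eq_vecI)
      fix r assume "r < dim_vec (col A j)"
      then have "r < dim_row A" by simp
      then show "col A i $ r = col A j $ r" using eq ij by auto
    qed simp
    then show "i = j" using nth_eq_iff_index_eq[OF assms, of i j] ij by simp
  qed simp
  then obtain F where F: "P F" and least: "\<And>F'. P F' \<Longrightarrow> card F \<le> card F'"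
    using ex_has_least_nat[of P "{..<dim_row A}" card] by blast
  have finF: "finite F" using F finite_subset unfolding P_def by blast
  have "\<exists>c. \<forall>v. c v < dim_col A \<and> A $$ (r, c v) = v \<and>
      (\<forall>s\<in>F - {r}. \<forall>v'. A $$ (s, c v) = A $$ (s, c v'))" if r: "r \<in> F" for r
  proof -
    have "\<not> P (F - {r})" using least[of "F - {r}"] r finF by (metis card_Diff1_less not_le)
    then obtain i j where ij: "i < dim_col A" "j < dim_col A" "i \<noteq> j"
      "{s \<in> F - {r}. A $$ (s, i)} = {s \<in> F - {r}. A $$ (s, j)}"
      using F unfolding P_def inj_on_def by auto
    have same: "A $$ (s, i) = A $$ (s, j)" if "s \<in> F - {r}" for s using ij(4) that by blast
    have "{s \<in> F. A $$ (s, i)} \<noteq> {s \<in> F. A $$ (s, j)}" using F ij unfolding P_def inj_on_def by auto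
    then have diff: "A $$ (r, i) \<noteq> A $$ (r, j)" using same r by blast
    show ?thesis
    proof (intro exI[of _ "\<lambda>v. if A $$ (r, i) = v then i else j"] allI conjI ballI)
      fix v
      show "(if A $$ (r, i) = v then i else j) < dim_col A" using ij by simp
      show "A $$ (r, if A $$ (r, i) = v then i else j) = v" using diff by auto
      show "A $$ (s, if A $$ (r, i) = v then i else j) = A $$ (s, if A $$ (r, i) = v' then i else j)"
        if "s \<in> F - {r}" for s v' using same[OF that] by auto
    qed
  qed
  then have "\<exists>c. \<forall>r\<in>F. \<forall>v. c r v < dim_col A \<and> A $$ (r, c r v) = v \<and>
      (\<forall>s\<in>F - {r}. \<forall>v'. A $$ (s, c r v) = A $$ (s, c r v'))" by metis
  then show ?thesis using F unfolding P_def by blast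
qed

lemma pattern_submatrix:
  fixes A :: "bool mat"
  assumes fin: "finite H" and HA: "H \<subseteq> {..<dim_row A}"
    and c: "\<And>r. r \<in> H \<Longrightarrow> c r < dim_col A"
    and diag: "\<And>r. r \<in> H \<Longrightarrow> A $$ (r, c r) = \<beta>"
    and up: "\<And>i j. i \<in> H \<Longrightarrow> j \<in> H \<Longrightarrow> i < j \<Longrightarrow> A $$ (i, c j) = \<alpha>"
    and down: "\<And>i j. i \<in> H \<Longrightarrow> j \<in> H \<Longrightarrow> i < j \<Longrightarrow> A $$ (j, c i) = \<gamma>"
    and inh: "inhomogeneous \<alpha> \<beta> \<gamma>"
  shows "\<exists>M. M \<in> carrier_mat (card H) (card H) \<and> submatrix_of M A \<and> pattern_matrix \<alpha> \<beta> \<gamma> M"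
proof -
  define k where "k = card H"
  define r where "r i = sorted_list_of_set H ! i" for i
  have rH: "r i \<in> H" if "i < k" for i
    using that fin unfolding r_def k_def by (metis nth_mem set_sorted_list_of_set length_sorted_list_of_set)
  have less: "r i < r j" if "i < j" "j < k" for i j
    using that fin strict_sorted_list_of_set[of H] unfolding r_def k_def
    by (simp add: sorted_wrt_nth_less)
  define M where "M = mat k k (\<lambda>(i, j). A $$ (r i, c (r j)))"
  have "inj_on r {..<k}"
    using less by (intro linorder_inj_onI) (auto simp: less_imp_neq)
  \<comment> \<open>If two of the chosen columns were the same, its entries in the two rows would
    force \<open>\<alpha> = \<beta> = \<gamma>\<close>. So distinctness comes from the
    inhomogeneity.\<close>
  moreover have "inj_on (\<lambda>j. c (r j)) {..<k}"
  proof (intro linorder_inj_onI)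
    fix i j assume "i < j" "i \<in> {..<k}" "j \<in> {..<k}"
    then have ij: "r i \<in> H" "r j \<in> H" "r i < r j" using rH less by auto
    show "c (r i) \<noteq> c (r j)"
    proof
      assume eq: "c (r i) = c (r j)"
      have "\<beta> = \<alpha>" using diag[OF ij(1)] up[OF ij] eq by simp
      moreover have "\<beta> = \<gamma>" using diag[OF ij(2)] down[OF ij] eq by simp
      ultimately show False using inh unfolding inhomogeneous_def by simp
    qed
  qed auto
  ultimately have "submatrix_of M A"
    unfolding submatrix_of_def using rH HA c
    by (intro exI[of _ r] exI[of _ "\<lambda>j. c (r j)"]) (auto simp: M_def)
  moreover have "pattern_matrix \<alpha> \<beta> \<gamma> M"
    unfolding pattern_matrix_def using rH less diag up down by (auto simp: M_def not_less le_less)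
  moreover have "M \<in> carrier_mat k k" unfolding M_def by simp
  ultimately show ?thesis unfolding k_def by blast
qed

text \<open>The exponent combines \<open>dim_col A \<le> (card F + 1) ^ d\<close>, by Sauer--Shelah
  for the separating rows, with \<open>card F \<le> card H ^ \<kappa>\<close>. Absorbing the
  \<open>+ 1\<close> into one more power takes \<open>2 \<le> card H\<close>; three columns
  guarantee it, since they need two separating rows.\<close>

lemma large_pattern:
  "\<exists>E>0. \<forall>A :: bool mat. vc_dim_mat A \<le> enat d \<longrightarrow> distinct (cols A) \<longrightarrow> 3 \<le> dim_col A \<longrightarrow>
     (\<exists>k \<alpha> \<beta> \<gamma> M. dim_col A \<le> k ^ E \<and> M \<in> carrier_mat k k \<and> submatrix_of M A \<and>
        pattern_matrix \<alpha> \<beta> \<gamma> M \<and> inhomogeneous \<alpha> \<beta> \<gamma>)"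
proof -
  obtain \<kappa> where \<kappa>: "\<forall>(Q :: nat \<Rightarrow> nat \<Rightarrow> bool) F. finite F \<longrightarrow>
    (\<forall>Y\<subseteq>F. card ((\<lambda>r. {y \<in> Y. Q y r}) ` F) \<le> (card Y + 1) ^ d) \<longrightarrow>
    (\<forall>Y\<subseteq>F. card ((\<lambda>r. {y \<in> Y. Q r y}) ` F) \<le> (card Y + 1) ^ d) \<longrightarrow>
    (\<exists>H\<subseteq>F. \<exists>\<alpha> \<gamma>. (\<forall>i\<in>H. \<forall>j\<in>H. i < j \<longrightarrow> Q i j = \<alpha> \<and> Q j i = \<gamma>) \<and> card F \<le> card H ^ \<kappa>)"
    using ordered_homogeneous_set[where 'a = nat and d = d] by (elim exE) (rule that)
  define E where "E = (\<kappa> + 1) * d + 1"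
  show ?thesis
  proof (rule exI[of _ E], intro conjI allI impI)
    fix A :: "bool mat"
    assume vc: "vc_dim_mat A \<le> enat d" and dist: "distinct (cols A)" and three: "3 \<le> dim_col A"
    define N where "N = dim_col A"
    have vcc: "vc_dim (column_system A) \<le> enat d" and vcr: "vc_dim (row_system A) \<le> enat d"
      using vc unfolding vc_dim_mat_def by auto
    obtain F c where FA: "F \<subseteq> {..<dim_row A}" and inj: "inj_on (\<lambda>j. {r \<in> F. A $$ (r, j)}) {..<N}"
      and sep: "\<forall>r\<in>F. \<forall>v. c r v < N \<and> A $$ (r, c r v) = v \<and> (\<forall>s\<in>F - {r}. \<forall>v'. A $$ (s, c r v) = A $$ (s, c r v'))"
      using separating_rows[OF dist] unfolding N_def by auto
    have c: "c r v < N" "A $$ (r, c r v) = v" if "r \<in> F" for r v using sep that by auto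
    have c3: "A $$ (s, c r v) = A $$ (s, c r v')" if "r \<in> F" "s \<in> F" "s \<noteq> r" for r s v v' using sep that by blast
    have finF: "finite F" using FA finite_subset by blast
    have colt: "card ((\<lambda>j. {r \<in> Y. A $$ (r, j)}) ` J) \<le> (card Y + 1) ^ d" if "Y \<subseteq> F" "J \<subseteq> {..<N}" for Y J
    proof -
      have finY: "finite Y" using that(1) finF finite_subset by blast
      have "(\<lambda>j. {r \<in> Y. A $$ (r, j)}) ` J \<subseteq> (\<lambda>T. Y \<inter> T) ` snd (column_system A)"
      proof
        fix S assume "S \<in> (\<lambda>j. {r \<in> Y. A $$ (r, j)}) ` J"
        then obtain j where j: "j \<in> J" "S = {r \<in> Y. A $$ (r, j)}" by blast
        then have "S = Y \<inter> {i. i < dim_row A \<and> A $$ (i, j)}" using that(1) FA by auto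
        then show "S \<in> (\<lambda>T. Y \<inter> T) ` snd (column_system A)"
          using j(1) that(2) unfolding column_system_def N_def by auto
      qed
      then have "card ((\<lambda>j. {r \<in> Y. A $$ (r, j)}) ` J) \<le> card ((\<lambda>T. Y \<inter> T) ` snd (column_system A))"
        by (intro card_mono) (auto simp: column_system_def)
      also have "\<dots> \<le> (card Y + 1) ^ d"
        using vcc that(1) FA finY by (intro card_traces_le_vc_dim[where X = "fst (column_system A)"])
          (auto simp: column_system_def)
      finally show ?thesis .
    qed
    define Q where "Q s r = A $$ (s, c r True)" for s r
    have "\<exists>H\<subseteq>F. \<exists>\<alpha> \<gamma>. (\<forall>i\<in>H. \<forall>j\<in>H. i < j \<longrightarrow> Q i j = \<alpha> \<and> Q j i = \<gamma>) \<and> card F \<le> card H ^ \<kappa>"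
    proof (rule \<kappa>[THEN spec, THEN spec, THEN mp, OF finF, THEN mp, THEN mp]; intro allI impI)
      fix Y assume Y: "Y \<subseteq> F"
      have "(\<lambda>r. {y \<in> Y. Q y r}) ` F = (\<lambda>j. {r \<in> Y. A $$ (r, j)}) ` ((\<lambda>r. c r True) ` F)"
        unfolding Q_def by (simp add: image_image)
      then show "card ((\<lambda>r. {y \<in> Y. Q y r}) ` F) \<le> (card Y + 1) ^ d"
        using colt[OF Y, of "(\<lambda>r. c r True) ` F"] c(1) by (simp add: image_subset_iff)
    next
      fix Y assume Y: "Y \<subseteq> F"
      \<comment> \<open>Row traces of \<open>Q\<close> on \<open>Y\<close> are pulled back from the
        traces of the row system on the columns \<open>J\<close>.\<close>
      define J where "J = (\<lambda>y. c y True) ` Y"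
      have finY: "finite Y" using Y finF finite_subset by blast
      have "(\<lambda>r. {y \<in> Y. Q r y}) ` F \<subseteq> (\<lambda>S. {y \<in> Y. c y True \<in> S}) ` ((\<lambda>T. J \<inter> T) ` snd (row_system A))"
      proof
        fix S assume "S \<in> (\<lambda>r. {y \<in> Y. Q r y}) ` F"
        then obtain r where r: "r \<in> F" "S = {y \<in> Y. A $$ (r, c y True)}" unfolding Q_def by blast
        define T where "T = {j. j < dim_col A \<and> A $$ (r, j)}"
        have "T \<in> snd (row_system A)" unfolding T_def row_system_def using r(1) FA by auto
        moreover have "S = {y \<in> Y. c y True \<in> J \<inter> T}"
          using r(2) Y c(1) unfolding T_def J_def N_def by auto
        ultimately show "S \<in> (\<lambda>S. {y \<in> Y. c y True \<in> S}) ` ((\<lambda>T. J \<inter> T) ` snd (row_system A))" by blast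
      qed
      then have "card ((\<lambda>r. {y \<in> Y. Q r y}) ` F) \<le> card ((\<lambda>T. J \<inter> T) ` snd (row_system A))"
        by (intro surj_card_le) (auto simp: row_system_def)
      also have "\<dots> \<le> (card J + 1) ^ d"
        using vcr Y c(1) finY by (intro card_traces_le_vc_dim[where X = "fst (row_system A)"])
          (auto simp: row_system_def J_def N_def)
      also have "\<dots> \<le> (card Y + 1) ^ d" unfolding J_def using card_image_le[OF finY] by (intro power_mono) auto
      finally show "card ((\<lambda>r. {y \<in> Y. Q r y}) ` F) \<le> (card Y + 1) ^ d" .
    qed
    then obtain H \<alpha> \<gamma> where H: "H \<subseteq> F" "\<forall>i\<in>H. \<forall>j\<in>H. i < j \<longrightarrow> Q i j = \<alpha> \<and> Q j i = \<gamma>"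
      "card F \<le> card H ^ \<kappa>" by (elim exE conjE) (rule that)
    have Q\<alpha>: "Q i j = \<alpha>" and Q\<gamma>: "Q j i = \<gamma>" if "i \<in> H" "j \<in> H" "i < j" for i j
      using H(2) that by simp_all
    \<comment> \<open>the diagonal value is ours to choose\<close>
    define \<beta> where "\<beta> \<longleftrightarrow> (\<alpha> = \<gamma> \<longrightarrow> \<not> \<alpha>)"
    have inh: "inhomogeneous \<alpha> \<beta> \<gamma>" unfolding inhomogeneous_def \<beta>_def by auto
    have Qc: "A $$ (s, c r \<beta>) = Q s r" if "r \<in> H" "s \<in> H" "s \<noteq> r" for r s
      using c3[of r s \<beta> True] that H(1) unfolding Q_def by auto
    have "\<exists>M. M \<in> carrier_mat (card H) (card H) \<and> submatrix_of M A \<and> pattern_matrix \<alpha> \<beta> \<gamma> M"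
    proof (rule pattern_submatrix[where c = "\<lambda>r. c r \<beta>"])
      show "finite H" "H \<subseteq> {..<dim_row A}" using H(1) finF FA finite_subset by auto
      show "c r \<beta> < dim_col A" "A $$ (r, c r \<beta>) = \<beta>" if "r \<in> H" for r
        using c(1,2) that H(1) unfolding N_def by auto
      show "A $$ (i, c j \<beta>) = \<alpha>" "A $$ (j, c i \<beta>) = \<gamma>" if "i \<in> H" "j \<in> H" "i < j" for i j
        using Qc[OF that(2,1)] Qc[OF that(1,2)] Q\<alpha>[OF that] Q\<gamma>[OF that] that(3) by simp_all
    qed (rule inh)
    moreover have "N \<le> card H ^ E"
    proof -
      have cN: "card ((\<lambda>j. {r \<in> F. A $$ (r, j)}) ` {..<N}) = N" using card_image[OF inj] by simp
      then have NF: "N \<le> (card F + 1) ^ d" using colt[of F "{..<N}"] by simp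
      have "(\<lambda>j. {r \<in> F. A $$ (r, j)}) ` {..<N} \<subseteq> Pow F" by auto
      then have "card ((\<lambda>j. {r \<in> F. A $$ (r, j)}) ` {..<N}) \<le> card (Pow F)"
        using finF by (intro card_mono) simp_all
      then have "N \<le> card (Pow F)" by (simp only: cN)
      then have N2: "3 \<le> (2::nat) ^ card F" using three card_Pow[OF finF] unfolding N_def by linarith
      have F2: "2 \<le> card F"
      proof (rule ccontr)
        assume "\<not> ?thesis"
        then have "(2::nat) ^ card F \<le> 2 ^ 1" by (intro power_increasing) linarith+
        then show False using N2 by (simp only: power_one_right)
      qed
      have h2: "2 \<le> card H"
      proof (rule ccontr)
        assume "\<not> ?thesis"
        then have "card H ^ \<kappa> \<le> 1 ^ \<kappa>" by (intro power_mono) linarith+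
        then have "card H ^ \<kappa> \<le> 1" by (simp only: power_one)
        then show False using F2 H(3) by linarith
      qed
      have "1 \<le> card H ^ \<kappa>" using h2 by (intro one_le_power) linarith
      then have "card F + 1 \<le> 2 * card H ^ \<kappa>" using H(3) by linarith
      also have "\<dots> \<le> card H * card H ^ \<kappa>" using h2 by (rule mult_le_mono1)
      also have "\<dots> = card H ^ (\<kappa> + 1)" by (simp only: Suc_eq_plus1[symmetric] power_Suc)
      finally have "(card F + 1) ^ d \<le> (card H ^ (\<kappa> + 1)) ^ d" by (intro power_mono le0)
      also have "\<dots> = card H ^ ((\<kappa> + 1) * d)" by (simp only: power_mult)
      also have "\<dots> \<le> card H ^ E" unfolding E_def using h2 by (intro power_increasing) linarith+
      finally show ?thesis using NF by linarith
    qed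
    ultimately show "\<exists>k \<alpha> \<beta> \<gamma> M. dim_col A \<le> k ^ E \<and> M \<in> carrier_mat k k \<and> submatrix_of M A \<and>
        pattern_matrix \<alpha> \<beta> \<gamma> M \<and> inhomogeneous \<alpha> \<beta> \<gamma>"
      using inh unfolding N_def by blast
  qed (simp add: E_def)
qed

theorem theorem3:
  fixes d :: nat
  shows "\<exists>c::real. c > 0 \<and>
    (\<forall>(n::nat) (A :: bool mat).
       dim_row A > 0 \<longrightarrow> n \<noteq> 2 \<longrightarrow>
       vc_dim_mat A \<le> enat d \<longrightarrow> dim_col A \<ge> n \<longrightarrow> distinct (cols A) \<longrightarrow>
       (\<exists>k \<alpha> \<beta> \<gamma> M. real k \<ge> real n powr c \<and>
          M \<in> carrier_mat k k \<and> submatrix_of M A \<and>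
          pattern_matrix \<alpha> \<beta> \<gamma> M \<and> inhomogeneous \<alpha> \<beta> \<gamma>))"
proof -
  obtain E where E: "0 < E" and large: "\<And>A :: bool mat. vc_dim_mat A \<le> enat d \<Longrightarrow> distinct (cols A) \<Longrightarrow> 3 \<le> dim_col A \<Longrightarrow>
     \<exists>k \<alpha> \<beta> \<gamma> M. dim_col A \<le> k ^ E \<and> M \<in> carrier_mat k k \<and> submatrix_of M A \<and>
        pattern_matrix \<alpha> \<beta> \<gamma> M \<and> inhomogeneous \<alpha> \<beta> \<gamma>"
    using large_pattern[of d] by blast
  show ?thesis
  proof (intro exI[of _ "1 / real E"] conjI allI impI)
    fix n :: nat and A :: "bool mat"
    assume row: "dim_row A > 0" and n2: "n \<noteq> 2" and vc: "vc_dim_mat A \<le> enat d"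
      and n: "dim_col A \<ge> n" and dist: "distinct (cols A)"
    \<comment> \<open>The value 2 has to be kept out: a single row with two distinct entries has no
      square submatrix beyond size 1, while \<open>2 powr c > 1\<close>.\<close>
    consider "n = 0" | "n = 1" | "3 \<le> n" using n2 by linarith
    then show "\<exists>k \<alpha> \<beta> \<gamma> M. real k \<ge> real n powr (1 / real E) \<and>
          M \<in> carrier_mat k k \<and> submatrix_of M A \<and>
          pattern_matrix \<alpha> \<beta> \<gamma> M \<and> inhomogeneous \<alpha> \<beta> \<gamma>"
    proof cases
      \<comment> \<open>\<open>0 powr c\<close> is 0, so the empty matrix suffices.\<close>
      case 1
      have "\<exists>M. M \<in> carrier_mat 0 0 \<and> submatrix_of M A \<and> pattern_matrix True False True M"
        using pattern_submatrix[of "{}" A "\<lambda>_. 0" False True True] by (auto simp: inhomogeneous_def)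
      then show ?thesis using 1
        by (intro exI[of _ 0] exI[of _ True] exI[of _ False] exI[of _ True]) (auto simp: inhomogeneous_def)
    next
      \<comment> \<open>A single entry is all diagonal, so the off-diagonal values can be chosen to
        make the triple inhomogeneous.\<close>
      case 2
      define \<beta> where "\<beta> = A $$ (0, 0)"
      have inh: "inhomogeneous (\<not> \<beta>) \<beta> (\<not> \<beta>)" unfolding inhomogeneous_def by auto
      have "\<exists>M. M \<in> carrier_mat 1 1 \<and> submatrix_of M A \<and> pattern_matrix (\<not> \<beta>) \<beta> (\<not> \<beta>) M"
      proof -
        have "\<exists>M. M \<in> carrier_mat (card {0::nat}) (card {0::nat}) \<and> submatrix_of M A \<and>
          pattern_matrix (\<not> \<beta>) \<beta> (\<not> \<beta>) M"
        proof (rule pattern_submatrix[where c = "\<lambda>_. 0"])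
          show "{0} \<subseteq> {..<dim_row A}" using row by simp
          show "0 < dim_col A" using n 2 by linarith
          show "A $$ (r, 0) = \<beta>" if "r \<in> {0}" for r using that by (simp add: \<beta>_def)
        qed (use inh in simp_all)
        then show ?thesis by simp
      qed
      then show ?thesis using 2 inh
        by (intro exI[of _ 1] exI[of _ "\<not> \<beta>"] exI[of _ \<beta>] exI[of _ "\<not> \<beta>"]) auto
    next
      case 3
      then have "3 \<le> dim_col A" using n by linarith
      then obtain k \<alpha> \<beta> \<gamma> M where k: "dim_col A \<le> k ^ E" and M: "M \<in> carrier_mat k k" "submatrix_of M A"
        "pattern_matrix \<alpha> \<beta> \<gamma> M" "inhomogeneous \<alpha> \<beta> \<gamma>" using large[OF vc dist] by blast
      have k0: "0 < k"
      proof (rule ccontr)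
        assume "\<not> 0 < k"
        then have "k ^ E = 0" using E by simp
        then show False using k \<open>3 \<le> dim_col A\<close> by linarith
      qed
      have "n \<le> k ^ E" using k n by linarith
      then have "real n \<le> real k ^ E" by (metis of_nat_le_iff of_nat_power)
      then have "real n powr (1 / real E) \<le> (real k ^ E) powr (1 / real E)"
        by (intro powr_mono2) auto
      also have "\<dots> = real k" using k0 E by (simp add: powr_realpow[symmetric] powr_powr)
      finally show ?thesis using M by blast
    qed
  qed (use E in simp)
qed

end
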